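(* Let $n\in\{2,3,4,5,6,7\}$ and let $\eta_1>0$. For $\eta>\eta_1$, let $P_\eta(T_{\eta_1}^{(n)}<\infty)$ be the probability that the $n$-dimensional hyperbolic Brownian motion, started at a point of $\mathbb{H}^n$ at hyperbolic distance $\eta$ from the origin $O_n$, ever hits the hyperbolic sphere of radius $\eta_1$ centered at $O_n$. Then $$\lim_{\eta\to\infty}\frac{1}{\eta}\log P_\eta(T_{\eta_1}^{(n)}<\infty)=-(n-1).$$
   Context: For an integer $n\geq 2$, $\mathbb{H}^n=\{z=(x,y):x\in\mathbb{R}^{n-1},\,y>0\}$ with origin $O_n=(0,\ldots,0,1)$ and Riemannian metric $ds^2=\frac{dx_1^2+\cdots+dx_{n-1}^2+dy^2}{y^2}$. The hyperbolic distance $\eta(z,z')$ between $z=(x,y)$ and $z'=(x',y')$ is given by $\cosh\eta(z,z')=\frac{|x-x'|^2+y^2+y'^2}{2yy'}$, where $|\cdot|$ is the Euclidean norm on $\mathbb{R}^{n-1}$. The Laplace-Beltrami operator is $\Delta_n=y^2\left(\sum_{i=1}^{n-1}\frac{\partial^2}{\partial x_i^2}+\frac{\partial^2}{\partial y^2}\right)-(n-2)\,y\frac{\partial}{\partial y}$. The hyperbolic Brownian motion is the diffusion on $\mathbb{H}^n$ with generator $\Delta_n/2$ (replacing the generator by a positive constant multiple does not change the hitting probabilities considered here). $T_{\eta_1}^{(n)}$ denotes the first hitting time by this process of the hyperbolic sphere $\{z\in\mathbb{H}^n:\eta(z,O_n)=\eta_1\}$, with $T_{\eta_1}^{(n)}=\infty$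 if the sphere is never hit; by rotational invariance, the probability $P_\eta(T_{\eta_1}^{(n)}<\infty)$ depends on the starting point only through its distance $\eta$ from $O_n$. *)

theory Defs
  imports "HOL-Probability.Probability"
begin

text \<open>
  Hyperbolic space of dimension \<open>n = CARD('m) + 1\<close> in the upper half-space model: a point is a
  pair \<open>(x, y)\<close> with \<open>x\<close> in \<open>real ^ 'm\<close> and \<open>y > 0\<close>.
\<close>

type_synonym 'm hpoint = "(real ^ 'm) \<times> real"

definition hyp_space :: "('m::finite) hpoint set" where
  "hyp_space = {z. snd z > 0}"

definition hyp_origin :: "('m::finite) hpoint" where
  "hyp_origin = (0, 1)"

definition hyp_dist :: "('m::finite) hpoint \<Rightarrow> 'm hpoint \<Rightarrow> real" where
  "hyp_dist z w = arcosh (((norm (fst z - fst w))\<^sup>2 + (snd z)\<^sup>2 + (snd w)\<^sup>2) / (2 * snd z * snd w))"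

lemma cosh_hyp_dist:
  assumes "z \<in> hyp_space" "w \<in> hyp_space"
  shows "hyp_dist z w \<ge> 0"
    and "cosh (hyp_dist z w) =
      ((norm (fst z - fst w))\<^sup>2 + (snd z)\<^sup>2 + (snd w)\<^sup>2) / (2 * snd z * snd w)"
proof -
  have pos: "snd z > 0" "snd w > 0"
    using assms by (auto simp: hyp_space_def)
  have "2 * snd z * snd w \<le> (snd z)\<^sup>2 + (snd w)\<^sup>2"
    by (rule sum_squares_bound)
  then have "2 * snd z * snd w \<le> (norm (fst z - fst w))\<^sup>2 + (snd z)\<^sup>2 + (snd w)\<^sup>2"
    using zero_le_power2[of "norm (fst z - fst w)"] by linarith
  then have ge: "((norm (fst z - fst w))\<^sup>2 + (snd z)\<^sup>2 + (snd w)\<^sup>2) / (2 * snd z * snd w) \<ge> 1"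
    using pos by (simp add: le_divide_eq)
  show "hyp_dist z w \<ge> 0"
    unfolding hyp_dist_def using ge by (rule arcosh_nonneg_real)
  show "cosh (hyp_dist z w) =
      ((norm (fst z - fst w))\<^sup>2 + (snd z)\<^sup>2 + (snd w)\<^sup>2) / (2 * snd z * snd w)"
    unfolding hyp_dist_def using ge by (rule cosh_arcosh_real)
qed

definition hyp_sphere :: "real \<Rightarrow> ('m::finite) hpoint set" where
  "hyp_sphere r = {z \<in> hyp_space. hyp_dist z hyp_origin = r}"

definition partial_deriv :: "'a::euclidean_space \<Rightarrow> ('a \<Rightarrow> real) \<Rightarrow> 'a \<Rightarrow> real" where
  "partial_deriv v f z = deriv (\<lambda>t. f (z + t *\<^sub>R v)) 0"

text \<open>\<open>C1_on\<close> and \<open>C2_on\<close> are meant for open sets.\<close>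

definition C1_on :: "'a::euclidean_space set \<Rightarrow> ('a \<Rightarrow> real) \<Rightarrow> bool" where
  "C1_on S f \<longleftrightarrow> (\<forall>v\<in>Basis.
     (\<forall>z\<in>S. (\<lambda>t. f (z + t *\<^sub>R v)) differentiable (at 0)) \<and>
     continuous_on S (partial_deriv v f))"

definition C2_on :: "'a::euclidean_space set \<Rightarrow> ('a \<Rightarrow> real) \<Rightarrow> bool" where
  "C2_on S f \<longleftrightarrow> C1_on S f \<and> (\<forall>v\<in>Basis. C1_on S (partial_deriv v f))"

definition hyp_test_functions :: "(('m::finite) hpoint \<Rightarrow> real) set" where
  "hyp_test_functions =
     {f. C2_on hyp_space f \<and>
         (\<exists>K. compact K \<and> K \<subseteq> hyp_space \<and> (\<forall>z. z \<notin> K \<longrightarrow> f z = 0))}"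

text \<open>
  The Laplace-Beltrami operator in half-space coordinates; the coefficient \<open>n - 2\<close> is
  \<open>CARD('m) - 1\<close>.
\<close>

definition hyp_laplacian :: "(('m::finite) hpoint \<Rightarrow> real) \<Rightarrow> 'm hpoint \<Rightarrow> real" where
  "hyp_laplacian f z =
     (snd z)\<^sup>2 *
       ((\<Sum>i\<in>UNIV. partial_deriv (axis i 1, 0) (partial_deriv (axis i 1, 0) f) z)
        + partial_deriv (0, 1) (partial_deriv (0, 1) f) z)
     - (real CARD('m) - 1) * snd z * partial_deriv (0, 1) f z"

text \<open>Processes are indexed by real times; only the values at times \<open>t \<ge> 0\<close> are relevant.\<close>

definition natural_filtration ::
    "'w measure \<Rightarrow> (real \<Rightarrow> 'w \<Rightarrow> 'a::topological_space) \<Rightarrow> real \<Rightarrow> 'w measure" where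
  "natural_filtration M X t =
     sigma (space M) {X s -` A \<inter> space M | s A. 0 \<le> s \<and> s \<le> t \<and> A \<in> sets borel}"

definition martingale ::
    "'w measure \<Rightarrow> (real \<Rightarrow> 'w measure) \<Rightarrow> (real \<Rightarrow> 'w \<Rightarrow> real) \<Rightarrow> bool" where
  "martingale M F Y \<longleftrightarrow>
     (\<forall>t\<ge>0. subalgebra M (F t)) \<and>
     (\<forall>t\<ge>0. Y t \<in> borel_measurable (F t) \<and> integrable M (Y t)) \<and>
     (\<forall>s t. 0 \<le> s \<and> s \<le> t \<longrightarrow>
        (AE \<omega> in M. real_cond_exp M (F s) (Y t) \<omega> = Y s \<omega>))"

text \<open>
  Hyperbolic Brownian motion started at \<open>z\<close>: the diffusion with generator \<open>\<Delta>\<^sub>n / 2\<close>, i.e. the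
  continuous process on hyperbolic space that solves the martingale problem for \<open>\<Delta>\<^sub>n / 2\<close>
  (well posed, as hyperbolic space is stochastically complete).
\<close>

definition hyperbolic_BM ::
    "'w measure \<Rightarrow> (real \<Rightarrow> 'w \<Rightarrow> ('m::finite) hpoint) \<Rightarrow> 'm hpoint \<Rightarrow> bool" where
  "hyperbolic_BM M X z \<longleftrightarrow>
     prob_space M \<and>
     z \<in> hyp_space \<and>
     (\<forall>t\<ge>0. X t \<in> borel_measurable M) \<and>
     (\<forall>t\<ge>0. \<forall>\<omega>\<in>space M. X t \<omega> \<in> hyp_space) \<and>
     (\<forall>\<omega>\<in>space M. continuous_on {0..} (\<lambda>t. X t \<omega>)) \<and>
     (AE \<omega> in M. X 0 \<omega> = z) \<and>
     (\<forall>f\<in>hyp_test_functions.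
        martingale M (natural_filtration M X)
          (\<lambda>t \<omega>. f (X t \<omega>) - f (X 0 \<omega>)
                  - integral {0..t} (\<lambda>s. hyp_laplacian f (X s \<omega>) / 2)))"

definition hitting_time :: "(real \<Rightarrow> 'w \<Rightarrow> 'a) \<Rightarrow> 'a set \<Rightarrow> 'w \<Rightarrow> ereal" where
  "hitting_time X A \<omega> = Inf {ereal t | t. 0 \<le> t \<and> X t \<omega> \<in> A}"

end

theory Submission
  imports Defs "HOL-Real_Asymp.Real_Asymp"
begin

text \<open>
  Let \<open>u\<close> be the hyperbolic cosine of the distance to the origin and let \<open>n\<close> be the dimension. The
  Laplacian of a radial function is \<open>\<Delta>(\<phi>(u)) = (u\<^sup>2 - 1) \<phi>''(u) + n u \<phi>'(u)\<close>
  (\<open>hyp_laplacian_radial\<close>). For \<open>\<phi>(c) = (c - b)\<close> to the power \<open>- (n - 1)\<close> this is a positive multiple of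
  \<open>b u - 1\<close> (\<open>radial_laplacian_inside\<close>). Hence \<open>b = 0\<close> yields a superharmonic function, and any \<open>b\<close>
  with \<open>1 / cosh \<eta>\<^sub>1 < b < 1\<close> yields one that is strictly subharmonic outside the ball of radius \<open>\<eta>\<^sub>1\<close>;
  both are smooth on the whole space, and both are of the order \<open>exp (- (n - 1) \<eta>)\<close> at distance \<open>\<eta>\<close>.
  Comparing them with the hitting probability traps it between two constant multiples of this rate.

  The comparison is optional stopping at the exit from an annulus around the origin, capped at a
  finite time. The martingale problem only speaks about compactly supported test functions and
  deterministic times. The first restriction is met by a cutoff beyond the outer radius, which the
  stopped path never sees (\<open>dynkin\<close>); the second by approximating the exit time from above on a
  refining time grid (\<open>optional_stopping\<close>). The superharmonic function bounds the probability from
  above (\<open>prob_hits_upper\<close>), the strictly subharmonic one from below (\<open>prob_hits_lower\<close>).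
\<close>

section \<open>Radial functions on hyperbolic space\<close>

definition cosh_rad :: "('m::finite) hpoint \<Rightarrow> real" where
  "cosh_rad w = ((norm (fst w))\<^sup>2 + (snd w)\<^sup>2 + 1) / (2 * snd w)"

text \<open>
  Directional derivatives of \<open>cosh_rad\<close>, written with the inner product of the product space so that
  one formula covers the horizontal and the vertical directions.
\<close>

definition cosh_rad_deriv :: "('m::finite) hpoint \<Rightarrow> 'm hpoint \<Rightarrow> real" where
  "cosh_rad_deriv v w = (w \<bullet> v - snd v * cosh_rad w) / snd w"

definition cosh_rad_deriv2 :: "('m::finite) hpoint \<Rightarrow> 'm hpoint \<Rightarrow> 'm hpoint \<Rightarrow> real" where
  "cosh_rad_deriv2 v v' w =
     (v \<bullet> v' - snd v * cosh_rad_deriv v' w - snd v' * cosh_rad_deriv v w) / snd w"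

lemma cosh_rad_eq:
  assumes "w \<in> hyp_space"
  shows "cosh (hyp_dist w hyp_origin) = cosh_rad w"
  using cosh_hyp_dist(2)[OF assms, of hyp_origin]
  by (simp add: hyp_space_def hyp_origin_def cosh_rad_def)

lemma cosh_rad_ge_1: "w \<in> hyp_space \<Longrightarrow> 1 \<le> cosh_rad w"
  by (metis cosh_rad_eq cosh_real_ge_1)

lemma open_hyp_space: "open (hyp_space :: ('m::finite) hpoint set)"
  unfolding hyp_space_def by (intro open_Collect_less continuous_intros)

lemma continuous_on_cosh_rad: "continuous_on hyp_space cosh_rad"
  unfolding cosh_rad_def hyp_space_def by (intro continuous_intros) auto

lemma continuous_on_cosh_rad_deriv: "continuous_on hyp_space (cosh_rad_deriv v)"
  unfolding cosh_rad_deriv_def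
  by (intro continuous_intros continuous_on_cosh_rad) (auto simp: hyp_space_def)

lemma continuous_on_cosh_rad_deriv2: "continuous_on hyp_space (cosh_rad_deriv2 v v')"
  unfolding cosh_rad_deriv2_def
  by (intro continuous_intros continuous_on_cosh_rad_deriv) (auto simp: hyp_space_def)

lemma cosh_rad_has_derivative:
  fixes v w :: "('m::finite) hpoint"
  assumes "w \<in> hyp_space"
  shows "((\<lambda>t. cosh_rad (w + t *\<^sub>R v)) has_real_derivative cosh_rad_deriv v w) (at 0)"
proof -
  have pos: "snd w > 0" using assms by (simp add: hyp_space_def)
  have eq: "cosh_rad (w + t *\<^sub>R v) =
      ((norm (fst w))\<^sup>2 + 2 * t * (fst w \<bullet> fst v) + t\<^sup>2 * (norm (fst v))\<^sup>2
        + (snd w + t * snd v)\<^sup>2 + 1) / (2 * (snd w + t * snd v))" for t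
  proof -
    have "(norm (fst w + t *\<^sub>R fst v))\<^sup>2 =
        (norm (fst w))\<^sup>2 + 2 * t * (fst w \<bullet> fst v) + t\<^sup>2 * (norm (fst v))\<^sup>2"
      unfolding power2_norm_eq_inner inner_add_left inner_add_right
      by (simp add: inner_commute power2_eq_square algebra_simps)
    then show ?thesis by (simp add: cosh_rad_def)
  qed
  have n: "((\<lambda>t. (norm (fst w))\<^sup>2 + 2 * t * (fst w \<bullet> fst v) + t\<^sup>2 * (norm (fst v))\<^sup>2
        + (snd w + t * snd v)\<^sup>2 + 1) has_real_derivative
      2 * (fst w \<bullet> fst v) + 2 * snd w * snd v) (at 0)"
    by (rule derivative_eq_intros refl | simp)+
  have d: "((\<lambda>t. 2 * (snd w + t * snd v)) has_real_derivative 2 * snd v) (at 0)"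
    by (rule derivative_eq_intros refl | simp)+
  have alg: "((2 * p + 2 * y * r) * (2 * y) - q * (2 * r)) / ((2 * y) * (2 * y)) =
      (p + y * r - r * (q / (2 * y))) / y" if "y > 0" for p q r y :: real
    using that by (simp add: field_simps)
  show ?thesis
    unfolding eq
    by (rule DERIV_cong[OF DERIV_divide[OF n d]])
      (use pos alg[OF pos] in \<open>simp_all add: cosh_rad_deriv_def cosh_rad_def inner_prod_def\<close>)
qed

lemma cosh_rad_deriv_has_derivative:
  fixes v w :: "('m::finite) hpoint"
  assumes "w \<in> hyp_space"
  shows "((\<lambda>t. cosh_rad_deriv v (w + t *\<^sub>R v')) has_real_derivative cosh_rad_deriv2 v v' w) (at 0)"
proof -
  have pos: "snd w > 0" using assms by (simp add: hyp_space_def)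
  have eq: "cosh_rad_deriv v (w + t *\<^sub>R v') =
      (w \<bullet> v + t * (v' \<bullet> v) - snd v * cosh_rad (w + t *\<^sub>R v')) / (snd w + t * snd v')" for t
    by (simp add: cosh_rad_deriv_def inner_add_left)
  have n: "((\<lambda>t. w \<bullet> v + t * (v' \<bullet> v) - snd v * cosh_rad (w + t *\<^sub>R v'))
      has_real_derivative v' \<bullet> v - snd v * cosh_rad_deriv v' w) (at 0)"
    by (rule derivative_eq_intros cosh_rad_has_derivative assms refl | simp)+
  have d: "((\<lambda>t. snd w + t * snd v') has_real_derivative snd v') (at 0)"
    by (rule derivative_eq_intros refl | simp)+
  show ?thesis
    unfolding eq
  proof (rule DERIV_cong[OF DERIV_divide[OF n d]])
    have alg: "((q - b * k) * y - (p - b * c) * r) / (y * y) = (q - b * k - r * ((p - b * c) / y)) / y"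
      if "y > 0" for q b k y p c r :: real
      using that by (simp add: field_simps)
    show "((v' \<bullet> v - snd v * cosh_rad_deriv v' w) * (snd w + 0 * snd v')
        - (w \<bullet> v + 0 * (v' \<bullet> v) - snd v * cosh_rad (w + 0 *\<^sub>R v')) * snd v')
        / ((snd w + 0 * snd v') * (snd w + 0 * snd v')) = cosh_rad_deriv2 v v' w"
      using alg[OF pos]
      by (simp add: cosh_rad_deriv2_def cosh_rad_deriv_def[of v w] inner_commute[of v' v])
  qed (use pos in simp)
qed

lemma partial_deriv_eqI:
  assumes "open S" "w \<in> S" "\<And>w'. w' \<in> S \<Longrightarrow> f w' = g w'"
    and "((\<lambda>t. g (w + t *\<^sub>R v)) has_real_derivative D) (at 0)"
  shows "(\<lambda>t. f (w + t *\<^sub>R v)) differentiable (at 0)" "partial_deriv v f w = D"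
proof -
  have "open ((\<lambda>t. w + t *\<^sub>R v) -` S)"
    by (intro open_vimage assms continuous_intros)
  moreover have "0 \<in> (\<lambda>t. w + t *\<^sub>R v) -` S"
    using assms by simp
  ultimately have "((\<lambda>t. f (w + t *\<^sub>R v)) has_real_derivative D) (at 0)"
    using assms(3) by (intro has_field_derivative_transform_within_open[OF assms(4)]) auto
  then show "(\<lambda>t. f (w + t *\<^sub>R v)) differentiable (at 0)" "partial_deriv v f w = D"
    unfolding partial_deriv_def by (auto simp: DERIV_imp_deriv real_differentiable_def)
qed

text \<open>
  Test functions live on the whole vector space and have to vanish off a compact subset of the half
  space, hence the value \<open>0\<close> outside.
\<close>

definition radial :: "(real \<Rightarrow> real) \<Rightarrow> ('m::finite) hpoint \<Rightarrow> real" where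
  "radial \<phi> w = (if w \<in> hyp_space then \<phi> (cosh_rad w) else 0)"

locale C2_profile =
  fixes \<phi> \<phi>' \<phi>'' :: "real \<Rightarrow> real"
  assumes deriv1: "\<And>c. 1 \<le> c \<Longrightarrow> (\<phi> has_real_derivative \<phi>' c) (at c)"
    and deriv2: "\<And>c. 1 \<le> c \<Longrightarrow> (\<phi>' has_real_derivative \<phi>'' c) (at c)"
    and cont2: "continuous_on {1..} \<phi>''"
begin

lemma cont0: "continuous_on {1..} \<phi>" and cont1: "continuous_on {1..} \<phi>'"
  using deriv1 deriv2 by (meson DERIV_continuous atLeast_iff continuous_at_imp_continuous_on)+

lemma
  assumes "w \<in> hyp_space"
  shows radial_differentiable: "(\<lambda>t. radial \<phi> (w + t *\<^sub>R v)) differentiable (at 0)"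
    and partial_deriv_radial: "partial_deriv v (radial \<phi>) w = \<phi>' (cosh_rad w) * cosh_rad_deriv v w"
proof -
  have "(\<phi> has_real_derivative \<phi>' (cosh_rad w)) (at (cosh_rad (w + 0 *\<^sub>R v)))"
    using deriv1[OF cosh_rad_ge_1[OF assms]] by simp
  note D = DERIV_chain2[OF this cosh_rad_has_derivative[OF assms]]
  show "(\<lambda>t. radial \<phi> (w + t *\<^sub>R v)) differentiable (at 0)"
    "partial_deriv v (radial \<phi>) w = \<phi>' (cosh_rad w) * cosh_rad_deriv v w"
    by (rule partial_deriv_eqI[OF open_hyp_space assms _ D]; simp add: radial_def)+
qed

lemma
  assumes "w \<in> hyp_space"
  shows partial_deriv_radial_differentiable:
      "(\<lambda>t. partial_deriv v (radial \<phi>) (w + t *\<^sub>R v')) differentiable (at 0)"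
    and partial_deriv2_radial: "partial_deriv v' (partial_deriv v (radial \<phi>)) w =
        \<phi>'' (cosh_rad w) * cosh_rad_deriv v w * cosh_rad_deriv v' w
        + \<phi>' (cosh_rad w) * cosh_rad_deriv2 v v' w"
proof -
  have "(\<phi>' has_real_derivative \<phi>'' (cosh_rad w)) (at (cosh_rad (w + 0 *\<^sub>R v')))"
    using deriv2[OF cosh_rad_ge_1[OF assms]] by simp
  note D0 = DERIV_chain2[OF this cosh_rad_has_derivative[OF assms]]
  have D: "((\<lambda>t. \<phi>' (cosh_rad (w + t *\<^sub>R v')) * cosh_rad_deriv v (w + t *\<^sub>R v'))
      has_real_derivative \<phi>'' (cosh_rad w) * cosh_rad_deriv v w * cosh_rad_deriv v' w
        + \<phi>' (cosh_rad w) * cosh_rad_deriv2 v v' w) (at 0)"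
    by (rule derivative_eq_intros D0 cosh_rad_deriv_has_derivative assms refl)+ simp
  show "(\<lambda>t. partial_deriv v (radial \<phi>) (w + t *\<^sub>R v')) differentiable (at 0)"
    "partial_deriv v' (partial_deriv v (radial \<phi>)) w =
        \<phi>'' (cosh_rad w) * cosh_rad_deriv v w * cosh_rad_deriv v' w
        + \<phi>' (cosh_rad w) * cosh_rad_deriv2 v v' w"
    by (rule partial_deriv_eqI[OF open_hyp_space assms _ D]; simp add: partial_deriv_radial)+
qed

lemma C2_on_radial: "C2_on hyp_space (radial \<phi> :: ('m::finite) hpoint \<Rightarrow> real)"
proof -
  have c: "continuous_on hyp_space (\<lambda>w :: 'm hpoint. g (cosh_rad w))"
    if "continuous_on {1..} g" for g :: "real \<Rightarrow> real"
    by (rule continuous_on_compose2[OF that continuous_on_cosh_rad]) (auto intro: cosh_rad_ge_1)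
  have "continuous_on hyp_space (partial_deriv v (radial \<phi>))" for v :: "'m hpoint"
    by (rule continuous_on_eq[of _ "\<lambda>w. \<phi>' (cosh_rad w) * cosh_rad_deriv v w"])
      (auto intro!: continuous_intros c cont1 continuous_on_cosh_rad_deriv
         simp: partial_deriv_radial)
  moreover have "continuous_on hyp_space (partial_deriv v' (partial_deriv v (radial \<phi>)))"
    for v v' :: "'m hpoint"
    by (rule continuous_on_eq[of _ "\<lambda>w. \<phi>'' (cosh_rad w) * cosh_rad_deriv v w * cosh_rad_deriv v' w
        + \<phi>' (cosh_rad w) * cosh_rad_deriv2 v v' w"])
      (auto intro!: continuous_intros c cont1 cont2 continuous_on_cosh_rad_deriv
         continuous_on_cosh_rad_deriv2 simp: partial_deriv2_radial)
  ultimately show ?thesis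
    unfolding C2_on_def C1_on_def
    using radial_differentiable partial_deriv_radial_differentiable by blast
qed

text \<open>
  With \<open>u = cosh_rad\<close> this is \<open>\<phi>''(u) |grad u|\<^sup>2 + \<phi>'(u) \<Delta>u\<close>, because the hyperbolic gradient
  satisfies \<open>|grad u|\<^sup>2 = u\<^sup>2 - 1\<close> and the Laplacian satisfies \<open>\<Delta>u = n u\<close>. In terms of \<open>u\<close> rather than of
  the distance, everything is polynomial and there is no singularity at the origin.
\<close>

lemma hyp_laplacian_radial:
  fixes w :: "('m::finite) hpoint"
  assumes "w \<in> hyp_space"
  shows "hyp_laplacian (radial \<phi>) w =
    ((cosh_rad w)\<^sup>2 - 1) * \<phi>'' (cosh_rad w) + (real CARD('m) + 1) * cosh_rad w * \<phi>' (cosh_rad w)"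
proof -
  obtain x y where w: "w = (x, y)" by (cases w)
  have y: "y > 0" using assms by (simp add: w hyp_space_def)
  define u where "u = cosh_rad w"
  have uy: "2 * u * y = (norm x)\<^sup>2 + y\<^sup>2 + 1"
    using y by (simp add: u_def w cosh_rad_def)
  have nx: "(\<Sum>i\<in>UNIV. x $ i * x $ i) = (norm x)\<^sup>2"
    by (simp add: power2_norm_eq_inner inner_vec_def)
  have i: "partial_deriv (axis i 1, 0) (partial_deriv (axis i 1, 0) (radial \<phi>)) w =
      \<phi>'' u * (x $ i * x $ i / y\<^sup>2) + \<phi>' u / y" for i
    by (simp add: partial_deriv2_radial[OF assms] flip: u_def)
      (simp add: w cosh_rad_deriv_def cosh_rad_deriv2_def inner_axis axis_eq_axis
         inner_axis_axis power2_eq_square)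
  have S: "(\<Sum>i\<in>UNIV. partial_deriv (axis i 1, 0) (partial_deriv (axis i 1, 0) (radial \<phi>)) w) =
      \<phi>'' u * ((norm x)\<^sup>2 / y\<^sup>2) + real CARD('m) * \<phi>' u / y"
    by (simp add: i sum.distrib flip: sum_distrib_left sum_divide_distrib nx)
  have d: "cosh_rad_deriv (0, 1) w = 1 - u / y"
    using y by (simp add: cosh_rad_deriv_def diff_divide_distrib flip: u_def) (simp add: w)
  have T: "partial_deriv (0, 1) (partial_deriv (0, 1) (radial \<phi>)) w =
      \<phi>'' u * (1 - u / y)\<^sup>2 + \<phi>' u * ((2 * u / y - 1) / y)"
    using y by (simp add: partial_deriv2_radial[OF assms] cosh_rad_deriv2_def d power2_eq_square
        flip: u_def) (simp add: w)
  have U: "partial_deriv (0, 1) (radial \<phi>) w = \<phi>' u * (1 - u / y)"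
    by (simp add: partial_deriv_radial[OF assms] d flip: u_def)
  have "hyp_laplacian (radial \<phi>) w =
      \<phi>'' u * ((norm x)\<^sup>2 + (y - u)\<^sup>2) + (real CARD('m) + 1) * u * \<phi>' u"
    unfolding hyp_laplacian_def S T U
    using y by (simp add: w) (simp add: field_simps power2_eq_square)
  also have "(norm x)\<^sup>2 + (y - u)\<^sup>2 = u\<^sup>2 - 1"
    using uy by (simp add: power2_eq_square algebra_simps)
  finally show ?thesis by (simp add: u_def mult_ac)
qed

end

text \<open>
  Hyperbolic balls are Euclidean balls: clearing the denominator turns \<open>cosh_rad w \<le> R\<close> into a
  quadratic inequality that cannot hold on the boundary \<open>snd w = 0\<close>.
\<close>

lemma compact_cosh_rad_le:
  "compact {w :: ('m::finite) hpoint. w \<in> hyp_space \<and> cosh_rad w \<le> R}" (is "compact ?K")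
proof -
  have K: "?K = {w. 0 \<le> snd w \<and> (norm (fst w))\<^sup>2 + (snd w)\<^sup>2 + 1 \<le> 2 * R * snd w}" (is "_ = ?K'")
  proof (intro set_eqI iffI)
    fix w :: "'m hpoint" assume w: "w \<in> ?K'"
    have "snd w \<noteq> 0"
    proof
      assume "snd w = 0"
      with w have "(norm (fst w))\<^sup>2 + 1 \<le> 0" by simp
      then show False using zero_le_power2[of "norm (fst w)"] by linarith
    qed
    with w show "w \<in> ?K" by (auto simp: hyp_space_def cosh_rad_def field_simps)
  qed (auto simp: hyp_space_def cosh_rad_def field_simps)
  have "closed ?K'"
    by (intro closed_Collect_conj closed_Collect_le continuous_intros)
  moreover have "bounded ?K'"
    unfolding bounded_iff
  proof (intro exI ballI)
    fix w :: "'m hpoint" assume w: "w \<in> ?K'"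
    have "(norm w)\<^sup>2 = (norm (fst w))\<^sup>2 + (snd w)\<^sup>2"
      by (simp add: norm_prod_def)
    also have "\<dots> \<le> 2 * R * snd w" using w by auto
    also have "\<dots> \<le> 2 * \<bar>R\<bar> * norm w"
    proof -
      have "R * snd w \<le> \<bar>R\<bar> * \<bar>snd w\<bar>" by (metis abs_ge_self abs_mult)
      also have "\<dots> \<le> \<bar>R\<bar> * norm w" using norm_snd_le[of "snd w" "fst w"] by (intro mult_left_mono) auto
      finally show ?thesis by simp
    qed
    finally show "norm w \<le> 2 * \<bar>R\<bar>"
      by (cases "norm w = 0") (auto simp: power2_eq_square)
  qed
  ultimately show ?thesis unfolding K by (simp add: compact_eq_bounded_closed)
qed

lemma (in C2_profile) radial_test_function:
  assumes "\<And>c. R \<le> c \<Longrightarrow> \<phi> c = 0"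
  shows "(radial \<phi> :: ('m::finite) hpoint \<Rightarrow> real) \<in> hyp_test_functions"
proof -
  have "radial \<phi> w = 0" if "w \<notin> {w \<in> hyp_space. cosh_rad w \<le> R}" for w :: "'m hpoint"
    using that assms by (auto simp: radial_def)
  then show ?thesis
    unfolding hyp_test_functions_def using C2_on_radial compact_cosh_rad_le[of R] by blast
qed

section \<open>Optional stopping for continuous martingales\<close>

lemma martingale_set_integral:
  assumes "prob_space M" "martingale M F Y" "0 \<le> s" "s \<le> t" "A \<in> sets (F s)"
  shows "(\<integral>\<omega>. indicator A \<omega> * Y t \<omega> \<partial>M) = (\<integral>\<omega>. indicator A \<omega> * Y s \<omega> \<partial>M)"
proof -
  interpret prob_space M by fact
  have sub: "subalgebra M (F s)" and int: "integrable M (Y t)"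
    using assms unfolding martingale_def by auto
  interpret finite_measure_subalgebra M "F s"
    by unfold_locales (rule sub)
  have "(\<integral>\<omega>. indicator A \<omega> * Y t \<omega> \<partial>M) = (\<integral>\<omega>. indicator A \<omega> * real_cond_exp M (F s) (Y t) \<omega> \<partial>M)"
    using real_cond_exp_intA[OF int assms(5)] by (simp add: set_lebesgue_integral_def)
  also have "\<dots> = (\<integral>\<omega>. indicator A \<omega> * Y s \<omega> \<partial>M)"
  proof (rule integral_cong_AE)
    have A: "A \<in> sets M" using sub assms(5) unfolding subalgebra_def by auto
    have "Y s \<in> borel_measurable M"
      using assms unfolding martingale_def by auto
    then show "(\<lambda>\<omega>. indicator A \<omega> * Y s \<omega>) \<in> borel_measurable M" using A by measurable
    show "(\<lambda>\<omega>. indicator A \<omega> * real_cond_exp M (F s) (Y t) \<omega>) \<in> borel_measurable M"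
      using A by measurable
    have "AE \<omega> in M. real_cond_exp M (F s) (Y t) \<omega> = Y s \<omega>"
      using assms unfolding martingale_def by auto
    then show "AE \<omega> in M. indicator A \<omega> * real_cond_exp M (F s) (Y t) \<omega> = indicator A \<omega> * Y s \<omega>"
      by eventually_elim simp
  qed
  finally show ?thesis .
qed

text \<open>
  Rounding \<open>\<tau>\<close> up to a grid of mesh \<open>t / (k + 1)\<close> writes the stopped value as \<open>Y\<^sub>0\<close> plus a sum of increments
  over the grid cells that start before \<open>\<tau>\<close>; each increment has mean zero on an event known when its
  cell starts. Path continuity and boundedness then let the mesh tend to zero.
\<close>

lemma optional_stopping:
  fixes Y :: "real \<Rightarrow> 'w \<Rightarrow> real" and \<tau> :: "'w \<Rightarrow> real"
  assumes "prob_space M" and mart: "martingale M F Y" and t: "0 < t"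
    and cont: "\<And>\<omega>. \<omega> \<in> space M \<Longrightarrow> continuous_on {0..t} (\<lambda>s. Y s \<omega>)"
    and bound: "\<And>s \<omega>. 0 \<le> s \<Longrightarrow> s \<le> t \<Longrightarrow> \<omega> \<in> space M \<Longrightarrow> \<bar>Y s \<omega>\<bar> \<le> B"
    and \<tau>: "\<And>\<omega>. \<omega> \<in> space M \<Longrightarrow> 0 \<le> \<tau> \<omega>" "\<And>\<omega>. \<omega> \<in> space M \<Longrightarrow> \<tau> \<omega> \<le> t"
    and stop: "\<And>s. 0 \<le> s \<Longrightarrow> s < t \<Longrightarrow> {\<omega> \<in> space M. s < \<tau> \<omega>} \<in> sets (F s)"
  shows "(\<lambda>\<omega>. Y (\<tau> \<omega>) \<omega>) \<in> borel_measurable M"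
    and "(\<integral>\<omega>. Y (\<tau> \<omega>) \<omega> \<partial>M) = (\<integral>\<omega>. Y 0 \<omega> \<partial>M)"
proof -
  interpret prob_space M by fact
  have int: "integrable M (Y s)" if "0 \<le> s" for s
    using mart that unfolding martingale_def by auto
  have sub: "sets (F s) \<subseteq> sets M" if "0 \<le> s" for s
    using mart that unfolding martingale_def subalgebra_def by auto
  define g where "g k j = real j * t / real (Suc k)" for k j
  define J where "J k \<omega> = nat \<lceil>\<tau> \<omega> * real (Suc k) / t\<rceil>" for k \<omega>
  define A where "A k j = {\<omega> \<in> space M. g k j < \<tau> \<omega>}" for k j
  have g0: "g k 0 = 0" and g_nonneg: "0 \<le> g k j" and g_mono: "g k j \<le> g k (Suc j)" for k j
    using t by (auto simp: g_def field_simps)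
  have J_le: "J k \<omega> \<le> Suc k" if "\<omega> \<in> space M" for k \<omega>
  proof -
    have "\<tau> \<omega> * real (Suc k) / t \<le> real (Suc k)"
      using \<tau>(2)[OF that] t by (simp add: pos_divide_le_eq mult.commute mult_right_mono)
    then have "\<lceil>\<tau> \<omega> * real (Suc k) / t\<rceil> \<le> int (Suc k)"
      by (simp only: ceiling_le_iff of_int_of_nat_eq)
    then show ?thesis unfolding J_def by (simp only: nat_le_iff)
  qed
  have J_less: "j < J k \<omega> \<longleftrightarrow> \<omega> \<in> A k j" if "\<omega> \<in> space M" for j k \<omega>
  proof -
    have "j < J k \<omega> \<longleftrightarrow> int j < \<lceil>\<tau> \<omega> * real (Suc k) / t\<rceil>"
      unfolding J_def by (simp add: zless_nat_eq_int_zless)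
    also have "\<dots> \<longleftrightarrow> g k j < \<tau> \<omega>"
      using t by (simp add: less_ceiling_iff g_def pos_less_divide_eq pos_divide_less_eq)
    finally show ?thesis using that by (simp add: A_def)
  qed
  have A_sets: "A k j \<in> sets (F (g k j))" if "j \<le> k" for k j
  proof -
    have "g k j < t" using that t by (simp add: g_def pos_divide_less_eq mult.commute)
    then show ?thesis unfolding A_def using g_nonneg stop by auto
  qed
  have gJ: "\<tau> \<omega> \<le> g k (J k \<omega>)" "g k (J k \<omega>) \<le> \<tau> \<omega> + t / real (Suc k)"
    "g k (J k \<omega>) \<le> t" if "\<omega> \<in> space M" for k \<omega>
  proof -
    show "\<tau> \<omega> \<le> g k (J k \<omega>)"
      using J_less[OF that, of "J k \<omega>" k] that by (auto simp: A_def)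
    show "g k (J k \<omega>) \<le> t"
      using J_le[OF that, of k] t unfolding g_def
      by (simp add: pos_divide_le_eq mult.commute mult_right_mono del: of_nat_Suc)
    show "g k (J k \<omega>) \<le> \<tau> \<omega> + t / real (Suc k)"
    proof (cases "J k \<omega>")
      case 0
      then show ?thesis using \<tau>(1)[OF that] t by (simp add: g0)
    next
      case (Suc j)
      then have "g k j < \<tau> \<omega>"
        using J_less[OF that, of j k] by (auto simp: A_def)
      then show ?thesis using Suc by (simp add: g_def add_divide_distrib distrib_right)
    qed
  qed
  \<comment> \<open>Each coefficient \<open>indicator (A k j)\<close> is known at the left end of its grid cell, so every
    summand has mean zero.\<close>
  have repr: "Y (g k (J k \<omega>)) \<omega> = Y 0 \<omega> + (\<Sum>j\<le>k. indicator (A k j) \<omega> * (Y (g k (Suc j)) \<omega> - Y (g k j) \<omega>))"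
    if "\<omega> \<in> space M" for k \<omega>
  proof -
    have "(\<Sum>j\<le>k. indicator (A k j) \<omega> * (Y (g k (Suc j)) \<omega> - Y (g k j) \<omega>)) =
        (\<Sum>j\<le>k. if j < J k \<omega> then Y (g k (Suc j)) \<omega> - Y (g k j) \<omega> else 0)"
      by (rule sum.cong) (auto simp: J_less[OF that])
    also have "\<dots> = (\<Sum>j<J k \<omega>. Y (g k (Suc j)) \<omega> - Y (g k j) \<omega>)"
      using J_le[OF that, of k] by (intro sum.mono_neutral_cong_right) auto
    also have "\<dots> = Y (g k (J k \<omega>)) \<omega> - Y (g k 0) \<omega>"
      by (rule sum_lessThan_telescope)
    finally show ?thesis by (simp add: g0)
  qed
  have term_int: "integrable M (\<lambda>\<omega>. indicator (A k j) \<omega> * Y s \<omega>)" if "j \<le> k" "0 \<le> s" for k j s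
    using integrable_mult_indicator[of "A k j" M "Y s"] int[OF that(2)] A_sets[OF that(1)] sub[OF g_nonneg]
    by auto
  have EJ: "(\<integral>\<omega>. Y (g k (J k \<omega>)) \<omega> \<partial>M) = (\<integral>\<omega>. Y 0 \<omega> \<partial>M)"
    and intJ: "integrable M (\<lambda>\<omega>. Y (g k (J k \<omega>)) \<omega>)" for k
  proof -
    let ?S = "\<lambda>\<omega>. Y 0 \<omega> + (\<Sum>j\<le>k. indicator (A k j) \<omega> * Y (g k (Suc j)) \<omega> - indicator (A k j) \<omega> * Y (g k j) \<omega>)"
    have eq: "Y (g k (J k \<omega>)) \<omega> = ?S \<omega>" if "\<omega> \<in> space M" for \<omega>
      using repr[OF that] by (simp add: right_diff_distrib)
    have i: "integrable M (\<lambda>\<omega>. indicator (A k j) \<omega> * Y (g k (Suc j)) \<omega> - indicator (A k j) \<omega> * Y (g k j) \<omega>)"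
      if "j \<le> k" for j
      using that by (intro Bochner_Integration.integrable_diff term_int g_nonneg)
    have "integrable M ?S"
      by (intro Bochner_Integration.integrable_add Bochner_Integration.integrable_sum int i) auto
    then show "integrable M (\<lambda>\<omega>. Y (g k (J k \<omega>)) \<omega>)"
      by (subst Bochner_Integration.integrable_cong[OF refl eq]) auto
    have "(\<integral>\<omega>. Y (g k (J k \<omega>)) \<omega> \<partial>M) = (\<integral>\<omega>. ?S \<omega> \<partial>M)"
      by (rule Bochner_Integration.integral_cong[OF refl eq])
    also have "\<dots> = (\<integral>\<omega>. Y 0 \<omega> \<partial>M) +
        (\<Sum>j\<le>k. (\<integral>\<omega>. indicator (A k j) \<omega> * Y (g k (Suc j)) \<omega> - indicator (A k j) \<omega> * Y (g k j) \<omega> \<partial>M))"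
      by (subst Bochner_Integration.integral_add, use int i in simp,
          intro Bochner_Integration.integrable_sum i, simp,
          subst Bochner_Integration.integral_sum, use i in auto)
    also have "(\<Sum>j\<le>k. (\<integral>\<omega>. indicator (A k j) \<omega> * Y (g k (Suc j)) \<omega> - indicator (A k j) \<omega> * Y (g k j) \<omega> \<partial>M)) = 0"
    proof (rule sum.neutral, intro ballI)
      fix j assume "j \<in> {..k}"
      then have j: "j \<le> k" by simp
      show "(\<integral>\<omega>. indicator (A k j) \<omega> * Y (g k (Suc j)) \<omega> - indicator (A k j) \<omega> * Y (g k j) \<omega> \<partial>M) = 0"
        using martingale_set_integral[OF \<open>prob_space M\<close> mart g_nonneg g_mono A_sets[OF j]]
        by (simp add: Bochner_Integration.integral_diff term_int j g_nonneg)
    qed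
    finally show "(\<integral>\<omega>. Y (g k (J k \<omega>)) \<omega> \<partial>M) = (\<integral>\<omega>. Y 0 \<omega> \<partial>M)" by simp
  qed
  have lim: "(\<lambda>k. Y (g k (J k \<omega>)) \<omega>) \<longlonglongrightarrow> Y (\<tau> \<omega>) \<omega>" if w: "\<omega> \<in> space M" for \<omega>
  proof -
    have "(\<lambda>k. t / real (Suc k)) \<longlonglongrightarrow> 0"
      by (rule LIMSEQ_Suc) (rule lim_const_over_n)
    then have u: "(\<lambda>k. \<tau> \<omega> + t / real (Suc k)) \<longlonglongrightarrow> \<tau> \<omega>"
      using tendsto_add[OF tendsto_const[of "\<tau> \<omega>"]] by force
    have "(\<lambda>k. g k (J k \<omega>)) \<longlonglongrightarrow> \<tau> \<omega>"
      by (rule tendsto_sandwich[OF _ _ tendsto_const u]) (use gJ[OF w] in auto)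
    then show ?thesis
      by (rule continuous_on_tendsto_compose[OF cont[OF w]])
        (use \<tau>[OF w] gJ(3)[OF w] g_nonneg in auto)
  qed
  show meas: "(\<lambda>\<omega>. Y (\<tau> \<omega>) \<omega>) \<in> borel_measurable M"
    by (rule borel_measurable_LIMSEQ_real[OF lim]) (use intJ in auto)
  have "(\<lambda>k. \<integral>\<omega>. Y (g k (J k \<omega>)) \<omega> \<partial>M) \<longlonglongrightarrow> (\<integral>\<omega>. Y (\<tau> \<omega>) \<omega> \<partial>M)"
    by (rule integral_dominated_convergence[where w = "\<lambda>_. B"])
      (use intJ meas lim bound g_nonneg gJ(3) in auto)
  then show "(\<integral>\<omega>. Y (\<tau> \<omega>) \<omega> \<partial>M) = (\<integral>\<omega>. Y 0 \<omega> \<partial>M)"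
    unfolding EJ by (simp add: LIMSEQ_const_iff)
qed

section \<open>Exit times\<close>

text \<open>
  The exit from the set where a path is positive, capped at \<open>t\<close>. The cap keeps the infimum over a
  nonempty set, so that it is attained.
\<close>

definition exit_time :: "real \<Rightarrow> (real \<Rightarrow> real) \<Rightarrow> real" where
  "exit_time t v = Inf (insert t {s \<in> {0..t}. v s \<le> 0})"

lemma exit_time:
  assumes t: "0 \<le> t" and cont: "continuous_on {0..t} v"
  shows exit_time_nonneg: "0 \<le> exit_time t v"
    and exit_time_le: "exit_time t v \<le> t"
    and exit_time_before: "\<And>s. 0 \<le> s \<Longrightarrow> s < exit_time t v \<Longrightarrow> 0 < v s"
    and exit_time_attained: "exit_time t v < t \<Longrightarrow> v (exit_time t v) \<le> 0"
proof -
  define K where "K = insert t {s \<in> {0..t}. v s \<le> 0}"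
  have "closed {s \<in> {0..t}. v s \<le> 0}"
    using cont by (intro continuous_on_closed_Collect_le continuous_on_const) auto
  then have K: "closed K" unfolding K_def by (rule closed_insert)
  have bdd: "bdd_below K" by (rule bdd_belowI[of _ 0]) (use t in \<open>auto simp: K_def\<close>)
  have mem: "exit_time t v \<in> K"
    unfolding exit_time_def K_def[symmetric]
    using K bdd by (intro closed_contains_Inf) (auto simp: K_def)
  have low: "exit_time t v \<le> s" if "s \<in> K" for s
    unfolding exit_time_def K_def[symmetric] by (rule cInf_lower[OF that bdd])
  show "0 \<le> exit_time t v" using mem t by (auto simp: K_def)
  show le: "exit_time t v \<le> t" by (rule low) (simp add: K_def)
  show "0 < v s" if "0 \<le> s" "s < exit_time t v" for s
    using low[of s] that le by (force simp: K_def not_le[symmetric])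
  show "v (exit_time t v) \<le> 0" if "exit_time t v < t"
    using mem that by (auto simp: K_def)
qed

lemma natural_filtration_measurable:
  fixes X :: "real \<Rightarrow> 'w \<Rightarrow> 'a::topological_space"
  assumes "0 \<le> u" "u \<le> s"
  shows "X u \<in> borel_measurable (natural_filtration M X s)"
  unfolding natural_filtration_def
  by (rule measurableI) (use assms in \<open>auto simp: space_measure_of_conv intro!: in_measure_of\<close>)

lemma space_natural_filtration [simp]: "space (natural_filtration M X s) = space M"
  unfolding natural_filtration_def by (simp add: space_measure_of_conv)

text \<open>
  A continuous function is positive on a compact interval iff it is bounded below there by some
  \<open>1 / (k + 1)\<close>, and this lower bound only has to be tested on a countable dense set of times.
\<close>

lemma path_positive_event:
  fixes X :: "real \<Rightarrow> 'w \<Rightarrow> 'a::topological_space"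
  assumes h: "h \<in> borel_measurable borel" and s: "0 \<le> s"
    and cont: "\<And>\<omega>. \<omega> \<in> space M \<Longrightarrow> continuous_on {0..s} (\<lambda>u. h (X u \<omega>) :: real)"
  shows "{\<omega> \<in> space M. \<forall>u\<in>{0..s}. 0 < h (X u \<omega>)} \<in> sets (natural_filtration M X s)"
proof -
  obtain D where D: "countable D" "D \<subseteq> {0..s}" "{0..s} \<subseteq> closure D"
    using separable by blast
  have cD: "closure D = {0..s}"
    using D closure_minimal[of D "{0..s}"] by auto
  have "(\<forall>u\<in>{0..s}. 0 < h (X u \<omega>)) \<longleftrightarrow> (\<exists>k. \<forall>d\<in>D. 1 / real (Suc k) \<le> h (X d \<omega>))"
    if w: "\<omega> \<in> space M" for \<omega>
  proof
    assume pos: "\<forall>u\<in>{0..s}. 0 < h (X u \<omega>)"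
    obtain m where m: "m \<in> {0..s}" "\<And>u. u \<in> {0..s} \<Longrightarrow> h (X m \<omega>) \<le> h (X u \<omega>)"
      using continuous_attains_inf[OF compact_Icc _ cont[OF w]] s by auto
    obtain k where "1 / real (Suc k) < h (X m \<omega>)"
      using pos m(1) nat_approx_posE by metis
    then show "\<exists>k. \<forall>d\<in>D. 1 / real (Suc k) \<le> h (X d \<omega>)"
      using m(2) D(2) by (intro exI[of _ k]) force
  next
    assume "\<exists>k. \<forall>d\<in>D. 1 / real (Suc k) \<le> h (X d \<omega>)"
    then obtain k where k: "\<And>d. d \<in> D \<Longrightarrow> 1 / real (Suc k) \<le> h (X d \<omega>)" by blast
    have "1 / real (Suc k) \<le> h (X u \<omega>)" if "u \<in> {0..s}" for u
      by (rule continuous_ge_on_closure[of D "\<lambda>u. h (X u \<omega>)"])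
        (use cont[OF w] that k in \<open>auto simp: cD\<close>)
    moreover have "0 < 1 / real (Suc k)" by simp
    ultimately show "\<forall>u\<in>{0..s}. 0 < h (X u \<omega>)" using less_le_trans by blast
  qed
  then have eq: "{\<omega> \<in> space M. \<forall>u\<in>{0..s}. 0 < h (X u \<omega>)} =
      {\<omega> \<in> space (natural_filtration M X s). \<exists>k. \<forall>d\<in>D. 1 / real (Suc k) \<le> h (X d \<omega>)}"
    by auto
  have "(\<lambda>\<omega>. h (X d \<omega>)) \<in> borel_measurable (natural_filtration M X s)" if "d \<in> D" for d
    using D(2) that by (intro measurable_compose[OF natural_filtration_measurable h]) auto
  then have "{\<omega> \<in> space (natural_filtration M X s). 1 / real (Suc k) \<le> h (X d \<omega>)}
      \<in> sets (natural_filtration M X s)" if "d \<in> D" for d k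
    using that by measurable
  then show ?thesis
    unfolding eq
    by (intro sets.sets_Collect_countable_Ex sets.sets_Collect_countable_All' D(1)) blast
qed

lemma exit_time_stopping:
  fixes X :: "real \<Rightarrow> 'w \<Rightarrow> 'a::topological_space"
  assumes h: "h \<in> borel_measurable borel" and s: "0 \<le> s" "s < t"
    and cont: "\<And>\<omega>. \<omega> \<in> space M \<Longrightarrow> continuous_on {0..t} (\<lambda>u. h (X u \<omega>) :: real)"
  shows "{\<omega> \<in> space M. s < exit_time t (\<lambda>u. h (X u \<omega>))} \<in> sets (natural_filtration M X s)"
proof -
  have "s < exit_time t (\<lambda>u. h (X u \<omega>)) \<longleftrightarrow> (\<forall>u\<in>{0..s}. 0 < h (X u \<omega>))"
    if w: "\<omega> \<in> space M" for \<omega>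
  proof -
    note e = exit_time[OF _ cont[OF w]]
    show ?thesis
    proof
      assume "s < exit_time t (\<lambda>u. h (X u \<omega>))"
      then show "\<forall>u\<in>{0..s}. 0 < h (X u \<omega>)" using e(3) s by auto
    next
      assume *: "\<forall>u\<in>{0..s}. 0 < h (X u \<omega>)"
      show "s < exit_time t (\<lambda>u. h (X u \<omega>))"
      proof (rule ccontr)
        assume "\<not> s < exit_time t (\<lambda>u. h (X u \<omega>))"
        then have "exit_time t (\<lambda>u. h (X u \<omega>)) \<in> {0..s}" "exit_time t (\<lambda>u. h (X u \<omega>)) < t"
          using e(1) s by auto
        with e(4) s * show False by force
      qed
    qed
  qed
  then have "{\<omega> \<in> space M. s < exit_time t (\<lambda>u. h (X u \<omega>))} =
      {\<omega> \<in> space M. \<forall>u\<in>{0..s}. 0 < h (X u \<omega>)}" by auto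
  moreover have "\<dots> \<in> sets (natural_filtration M X s)"
    by (rule path_positive_event[OF h s(1)]) (use s in \<open>auto intro: continuous_on_subset[OF cont]\<close>)
  ultimately show ?thesis by simp
qed

section \<open>Sub- and superharmonic test functions\<close>

lemma pos_part_power_has_derivative:
  fixes x :: real
  assumes "2 \<le> n"
  shows "((\<lambda>x. max 0 x ^ n) has_real_derivative real n * max 0 x ^ (n - 1)) (at x)"
proof -
  obtain k where n: "n = Suc (Suc k)" using assms by (metis Suc_le_D numeral_2_eq_2 Suc_le_mono)
  consider "x < 0" | "x = 0" | "0 < x" by linarith
  then show ?thesis
  proof cases
    case 1
    have "((\<lambda>x. 0) has_real_derivative real n * max 0 x ^ (n - 1)) (at x)"
      using 1 by (simp add: n)
    then show ?thesis
      by (rule has_field_derivative_transform_within_open[of _ _ _ "{..<0}"]) (use 1 in \<open>auto simp: n\<close>)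
  next
    case 2
    have "(\<lambda>h::real. max 0 h ^ Suc k) \<midarrow>0\<rightarrow> max 0 0 ^ Suc k"
      by (intro tendsto_intros)
    moreover have "max 0 h ^ Suc k = (max 0 h ^ n - max 0 0 ^ n) / h" if "h \<noteq> 0" for h :: real
      using that by (auto simp: n max_def)
    ultimately have "(\<lambda>h::real. (max 0 h ^ n - max 0 0 ^ n) / h) \<midarrow>0\<rightarrow> 0"
      by (subst (asm) LIM_equal) auto
    then show ?thesis using 2 by (simp add: DERIV_def n)
  next
    case 3
    have "((\<lambda>x. x ^ n) has_real_derivative real n * max 0 x ^ (n - 1)) (at x)"
      using 3 by (auto intro!: derivative_eq_intros)
    then show ?thesis
      by (rule has_field_derivative_transform_within_open[of _ _ _ "{0<..}"]) (use 3 in auto)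
  qed
qed

text \<open>
  A cutoff that is \<open>1\<close> up to \<open>R\<close> and \<open>0\<close> from \<open>R + 1\<close> on. The cube of the positive part is the lowest
  power that is twice continuously differentiable.
\<close>

definition cutoff :: "real \<Rightarrow> real \<Rightarrow> real" where
  "cutoff R c = max 0 (1 - max 0 (c - R) ^ 3) ^ 3"

definition cutoff' :: "real \<Rightarrow> real \<Rightarrow> real" where
  "cutoff' R c = - 9 * max 0 (1 - max 0 (c - R) ^ 3) ^ 2 * max 0 (c - R) ^ 2"

definition cutoff'' :: "real \<Rightarrow> real \<Rightarrow> real" where
  "cutoff'' R c = 54 * max 0 (1 - max 0 (c - R) ^ 3) * max 0 (c - R) ^ 4
     - 18 * max 0 (1 - max 0 (c - R) ^ 3) ^ 2 * max 0 (c - R)"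

lemma cutoff_has_derivative:
  "(cutoff R has_real_derivative cutoff' R c) (at c)"
  "(cutoff' R has_real_derivative cutoff'' R c) (at c)"
proof -
  have k: "((\<lambda>c. c - R) has_real_derivative 1) (at c)" for c
    by (auto intro!: derivative_eq_intros)
  have k3: "((\<lambda>c. max 0 (c - R) ^ 3) has_real_derivative 3 * max 0 (c - R) ^ 2) (at c)"
    using DERIV_chain2[OF pos_part_power_has_derivative[of 3 "c - R"] k] by simp
  have k2: "((\<lambda>c. max 0 (c - R) ^ 2) has_real_derivative 2 * max 0 (c - R)) (at c)"
    using DERIV_chain2[OF pos_part_power_has_derivative[of 2 "c - R"] k] by simp
  have m: "((\<lambda>c. 1 - max 0 (c - R) ^ 3) has_real_derivative - (3 * max 0 (c - R) ^ 2)) (at c)"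
    by (rule derivative_eq_intros k3 refl | simp)+
  have m3: "((\<lambda>c. max 0 (1 - max 0 (c - R) ^ 3) ^ 3) has_real_derivative
      3 * max 0 (1 - max 0 (c - R) ^ 3) ^ 2 * - (3 * max 0 (c - R) ^ 2)) (at c)"
    using DERIV_chain2[OF pos_part_power_has_derivative[of 3 "1 - max 0 (c - R) ^ 3"] m] by simp
  have m2: "((\<lambda>c. max 0 (1 - max 0 (c - R) ^ 3) ^ 2) has_real_derivative
      2 * max 0 (1 - max 0 (c - R) ^ 3) * - (3 * max 0 (c - R) ^ 2)) (at c)"
    using DERIV_chain2[OF pos_part_power_has_derivative[of 2 "1 - max 0 (c - R) ^ 3"] m] by simp
  show "(cutoff R has_real_derivative cutoff' R c) (at c)"
    using m3 unfolding cutoff_def[abs_def] cutoff'_def by (simp add: mult.assoc)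
  have eq: "cutoff' R = (\<lambda>c. - 9 * (max 0 (1 - max 0 (c - R) ^ 3) ^ 2 * max 0 (c - R) ^ 2))"
    by (simp add: fun_eq_iff cutoff'_def)
  have "((\<lambda>c. - 9 * (max 0 (1 - max 0 (c - R) ^ 3) ^ 2 * max 0 (c - R) ^ 2)) has_real_derivative
      - 9 * (2 * max 0 (1 - max 0 (c - R) ^ 3) * - (3 * max 0 (c - R) ^ 2) * max 0 (c - R) ^ 2
        + 2 * max 0 (c - R) * max 0 (1 - max 0 (c - R) ^ 3) ^ 2)) (at c)"
    by (intro DERIV_cmult DERIV_mult m2 k2)
  then show "(cutoff' R has_real_derivative cutoff'' R c) (at c)"
    unfolding eq
    by (rule DERIV_cong) (simp add: cutoff''_def algebra_simps power2_eq_square power4_eq_xxxx)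
qed

lemma cutoff_inside: "c \<le> R \<Longrightarrow> cutoff R c = 1" "c \<le> R \<Longrightarrow> cutoff' R c = 0" "c \<le> R \<Longrightarrow> cutoff'' R c = 0"
  by (auto simp: cutoff_def cutoff'_def cutoff''_def)

lemma cutoff_outside:
  assumes "R + 1 \<le> c"
  shows "cutoff R c = 0" "cutoff' R c = 0" "cutoff'' R c = 0"
proof -
  have "1 \<le> max 0 (c - R) ^ 3" using assms by (intro one_le_power) auto
  then show "cutoff R c = 0" "cutoff' R c = 0" "cutoff'' R c = 0"
    by (auto simp: cutoff_def cutoff'_def cutoff''_def)
qed

definition neg_power :: "real \<Rightarrow> nat \<Rightarrow> real \<Rightarrow> real" where
  "neg_power b k c = 1 / (c - b) ^ k"

lemma neg_power_has_derivative:
  assumes "b < c"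
  shows "(neg_power b k has_real_derivative - real k * neg_power b (Suc k) c) (at c)"
proof (cases k)
  case 0
  then show ?thesis by (simp add: neg_power_def[abs_def])
next
  case (Suc j)
  have p: "((\<lambda>c. (c - b) ^ Suc j) has_real_derivative real (Suc j) * (c - b) ^ j) (at c)"
    by (rule derivative_eq_intros refl | simp)+
  have alg: "(0 * (x * y) - 1 * (r * y)) / ((x * y) * (x * y)) = - r * (1 / (x * (x * y)))"
    if "x > 0" "y > 0" for x y r :: real
    using that by (simp add: field_simps)
  show ?thesis
    unfolding neg_power_def[abs_def] Suc
    using DERIV_divide[OF DERIV_const[of 1] p] alg[of "c - b" "(c - b) ^ j" "real (Suc j)"] assms
    by simp
qed

definition trunc_power :: "real \<Rightarrow> nat \<Rightarrow> real \<Rightarrow> real \<Rightarrow> real" where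
  "trunc_power b k R c = neg_power b k c * cutoff R c"

definition trunc_power' :: "real \<Rightarrow> nat \<Rightarrow> real \<Rightarrow> real \<Rightarrow> real" where
  "trunc_power' b k R c =
     - real k * neg_power b (Suc k) c * cutoff R c + neg_power b k c * cutoff' R c"

definition trunc_power'' :: "real \<Rightarrow> nat \<Rightarrow> real \<Rightarrow> real \<Rightarrow> real" where
  "trunc_power'' b k R c =
     real k * real (Suc k) * neg_power b (Suc (Suc k)) c * cutoff R c
     - 2 * real k * neg_power b (Suc k) c * cutoff' R c + neg_power b k c * cutoff'' R c"

lemma trunc_power_profile:
  assumes "b < 1"
  shows "C2_profile (trunc_power b k R) (trunc_power' b k R) (trunc_power'' b k R)"
proof
  note D = neg_power_has_derivative cutoff_has_derivative
  fix c :: real assume "1 \<le> c"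
  with assms have c: "b < c" by simp
  show "(trunc_power b k R has_real_derivative trunc_power' b k R c) (at c)"
    unfolding trunc_power_def[abs_def] trunc_power'_def
    by (rule derivative_eq_intros D c refl)+ (simp add: algebra_simps)
  show "(trunc_power' b k R has_real_derivative trunc_power'' b k R c) (at c)"
    unfolding trunc_power'_def[abs_def] trunc_power''_def
    by (rule derivative_eq_intros D c refl)+ (simp add: algebra_simps)
next
  have "continuous_on {1..} (neg_power b j)" for j
    unfolding neg_power_def[abs_def] using assms by (intro continuous_intros) auto
  moreover have "continuous_on {1..} (cutoff R)" "continuous_on {1..} (cutoff' R)"
    "continuous_on {1..} (cutoff'' R)"
    unfolding cutoff_def[abs_def] cutoff'_def[abs_def] cutoff''_def[abs_def]
    by (intro continuous_intros)+
  ultimately show "continuous_on {1..} (trunc_power'' b k R)"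
    unfolding trunc_power''_def[abs_def] by (intro continuous_intros)
qed

text \<open>
  The Laplacian of \<open>trunc_power b k R\<close> composed with \<open>cosh_rad\<close>, in dimension \<open>k + 1\<close>.
\<close>

definition radial_laplacian :: "real \<Rightarrow> nat \<Rightarrow> real \<Rightarrow> real \<Rightarrow> real" where
  "radial_laplacian b k R c =
     (c\<^sup>2 - 1) * trunc_power'' b k R c + (real k + 1) * c * trunc_power' b k R c"

text \<open>
  For the exponent \<open>k = n - 1\<close> the two terms of order \<open>c\<^sup>2\<close> cancel, and the sign of the Laplacian is that
  of \<open>b * c - 1\<close>. So \<open>b = 0\<close> gives a superharmonic function, while any \<open>b > 0\<close> gives a function that is
  strictly subharmonic where \<open>c > 1 / b\<close>; both decay like \<open>c\<close> to the power \<open>- k\<close>.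
\<close>

lemma radial_laplacian_inside:
  assumes "c \<le> R" "b < c"
  shows "radial_laplacian b k R c = real k * (real k + 1) * (b * c - 1) * neg_power b (Suc (Suc k)) c"
proof -
  have e: "neg_power b (Suc k) c = (c - b) * neg_power b (Suc (Suc k)) c"
    using assms by (simp add: neg_power_def)
  show ?thesis
    using assms
    by (simp add: radial_laplacian_def trunc_power'_def trunc_power''_def cutoff_inside e)
      (simp add: algebra_simps power2_eq_square)
qed

lemma bounded_profile:
  assumes "continuous_on {1..} (f :: real \<Rightarrow> real)" "\<And>c. R + 1 \<le> c \<Longrightarrow> f c = 0"
  obtains B where "0 \<le> B" "\<And>c. 1 \<le> c \<Longrightarrow> \<bar>f c\<bar> \<le> B"
proof -
  have "bounded (f ` {1..R + 1})"
    by (intro compact_imp_bounded compact_continuous_image continuous_on_subset[OF assms(1)]) auto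
  then obtain B where B: "\<And>c. c \<in> {1..R + 1} \<Longrightarrow> \<bar>f c\<bar> \<le> B"
    unfolding bounded_iff by (metis imageI real_norm_def)
  show ?thesis
  proof
    show "\<bar>f c\<bar> \<le> max 0 B" if "1 \<le> c" for c
      using B[of c] assms(2)[of c] that by (cases "c \<le> R + 1") auto
  qed simp
qed

lemma test_function:
  fixes b R :: real
  assumes b: "b < 1"
  defines "f \<equiv> (radial (trunc_power b CARD('m) R) :: ('m::finite) hpoint \<Rightarrow> real)"
  shows "f \<in> hyp_test_functions"
    and "\<And>w. w \<in> hyp_space \<Longrightarrow> f w = trunc_power b CARD('m) R (cosh_rad w)"
    and "\<And>w. w \<in> hyp_space \<Longrightarrow> hyp_laplacian f w = radial_laplacian b CARD('m) R (cosh_rad w)"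
    and "continuous_on {1..} (trunc_power b CARD('m) R)"
    and "continuous_on {1..} (radial_laplacian b CARD('m) R)"
    and "\<exists>B. \<forall>c\<ge>1. \<bar>trunc_power b CARD('m) R c\<bar> \<le> B"
    and "\<exists>B. \<forall>c\<ge>1. \<bar>radial_laplacian b CARD('m) R c\<bar> \<le> B"
proof -
  interpret C2_profile "trunc_power b CARD('m) R" "trunc_power' b CARD('m) R" "trunc_power'' b CARD('m) R"
    by (rule trunc_power_profile[OF b])
  show "f \<in> hyp_test_functions"
    unfolding f_def by (rule radial_test_function[of "R + 1"]) (simp add: trunc_power_def cutoff_outside)
  show "f w = trunc_power b CARD('m) R (cosh_rad w)" if "w \<in> hyp_space" for w
    using that by (simp add: f_def radial_def)
  show "hyp_laplacian f w = radial_laplacian b CARD('m) R (cosh_rad w)" if "w \<in> hyp_space" for w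
    unfolding f_def hyp_laplacian_radial[OF that] radial_laplacian_def ..
  show c0: "continuous_on {1..} (trunc_power b CARD('m) R)" by (rule cont0)
  show c2: "continuous_on {1..} (radial_laplacian b CARD('m) R)"
    unfolding radial_laplacian_def[abs_def] by (intro continuous_intros cont1 cont2)
  show "\<exists>B. \<forall>c\<ge>1. \<bar>trunc_power b CARD('m) R c\<bar> \<le> B"
    by (rule bounded_profile[OF c0, of R]) (auto simp: trunc_power_def cutoff_outside)
  show "\<exists>B. \<forall>c\<ge>1. \<bar>radial_laplacian b CARD('m) R c\<bar> \<le> B"
    by (rule bounded_profile[OF c2, of R])
      (auto simp: radial_laplacian_def trunc_power'_def trunc_power''_def cutoff_outside)
qed

section \<open>Hitting probabilities of hyperbolic Brownian motion\<close>

locale hyp_BM =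
  fixes M :: "'w measure" and X :: "real \<Rightarrow> 'w \<Rightarrow> ('m::finite) hpoint" and z :: "'m hpoint"
  assumes BM: "hyperbolic_BM M X z"
begin

definition Z :: "real \<Rightarrow> 'w \<Rightarrow> real" where
  "Z s \<omega> = cosh_rad (X s \<omega>)"

text \<open>
  Exit from the annulus in which \<open>cosh_rad\<close> lies strictly between \<open>a\<close> and \<open>R\<close>, capped at time \<open>t\<close>.
\<close>

definition \<sigma> :: "real \<Rightarrow> real \<Rightarrow> real \<Rightarrow> 'w \<Rightarrow> real" where
  "\<sigma> a R t \<omega> = exit_time t (\<lambda>s. min (Z s \<omega> - a) (R - Z s \<omega>))"

lemma prob: "prob_space M" and z_in: "z \<in> hyp_space"
  and X_in: "0 \<le> s \<Longrightarrow> \<omega> \<in> space M \<Longrightarrow> X s \<omega> \<in> hyp_space"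
  and X_cont: "\<omega> \<in> space M \<Longrightarrow> continuous_on {0..} (\<lambda>s. X s \<omega>)"
  and X_start: "AE \<omega> in M. X 0 \<omega> = z"
  and X_martingale: "f \<in> hyp_test_functions \<Longrightarrow> martingale M (natural_filtration M X)
      (\<lambda>t \<omega>. f (X t \<omega>) - f (X 0 \<omega>) - integral {0..t} (\<lambda>s. hyp_laplacian f (X s \<omega>) / 2))"
  using BM unfolding hyperbolic_BM_def by auto

sublocale prob_space M by (rule prob)

lemma Z_ge_1: "0 \<le> s \<Longrightarrow> \<omega> \<in> space M \<Longrightarrow> 1 \<le> Z s \<omega>"
  unfolding Z_def by (intro cosh_rad_ge_1 X_in)

lemma Z_start: "AE \<omega> in M. Z 0 \<omega> = cosh_rad z"
  using X_start by eventually_elim (simp add: Z_def)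

lemma Z_cont: "\<omega> \<in> space M \<Longrightarrow> continuous_on {0..t} (\<lambda>s. Z s \<omega>)"
  unfolding Z_def
  by (rule continuous_on_compose2[OF continuous_on_cosh_rad])
    (auto intro: continuous_on_subset[OF X_cont] X_in)

lemma cosh_rad_measurable: "cosh_rad \<in> borel_measurable borel"
  unfolding cosh_rad_def[abs_def]
  by (intro borel_measurable_divide borel_measurable_continuous_onI continuous_intros)

lemma natural_filtration_sets:
  assumes "0 \<le> t"
  shows "sets (natural_filtration M X t) \<subseteq> sets M"
proof -
  from X_martingale[OF test_function(1)[of 0]] show ?thesis
    using assms unfolding martingale_def subalgebra_def by auto
qed


lemma
  assumes a: "a < Z 0 \<omega>" and R: "Z 0 \<omega> < R" and t: "0 < t" and w: "\<omega> \<in> space M"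
  shows \<sigma>_nonneg: "0 \<le> \<sigma> a R t \<omega>" and \<sigma>_le: "\<sigma> a R t \<omega> \<le> t"
    and Z_annulus: "\<And>s. 0 \<le> s \<Longrightarrow> s \<le> \<sigma> a R t \<omega> \<Longrightarrow> a \<le> Z s \<omega> \<and> Z s \<omega> \<le> R"
    and Z_inside: "\<And>s. 0 \<le> s \<Longrightarrow> s < \<sigma> a R t \<omega> \<Longrightarrow> a < Z s \<omega> \<and> Z s \<omega> < R"
    and Z_exit: "\<sigma> a R t \<omega> < t \<Longrightarrow> Z (\<sigma> a R t \<omega>) \<omega> = a \<or> Z (\<sigma> a R t \<omega>) \<omega> = R"
proof -
  define T where "T = \<sigma> a R t \<omega>"
  have "continuous_on {0..t} (\<lambda>s. min (Z s \<omega> - a) (R - Z s \<omega>))"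
    by (intro continuous_intros Z_cont w)
  note e = exit_time[OF less_imp_le[OF t] this, folded \<sigma>_def, folded T_def]
  show T0: "0 \<le> \<sigma> a R t \<omega>" and Tt: "\<sigma> a R t \<omega> \<le> t" using e(1,2) by (auto simp: T_def)
  show ins: "a < Z s \<omega> \<and> Z s \<omega> < R" if "0 \<le> s" "s < \<sigma> a R t \<omega>" for s
    using e(3)[of s] that by (auto simp: T_def)
  have T: "a \<le> Z T \<omega> \<and> Z T \<omega> \<le> R"
  proof (cases "T = 0")
    case True
    then show ?thesis using a R by simp
  next
    case False
    then have "0 < T" using T0 T_def by simp
    then have cl: "closure {0..<T} = {0..T}" by simp
    have c: "continuous_on (closure {0..<T}) (\<lambda>s. Z s \<omega>)"
      unfolding cl by (rule Z_cont[OF w])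
    have "Z T \<omega> \<le> R"
      by (rule continuous_le_on_closure[OF c]) (use ins \<open>0 < T\<close> in \<open>auto simp: T_def less_imp_le simp del: closure_atLeastLessThan, simp add: cl[unfolded T_def]\<close>)
    moreover have "a \<le> Z T \<omega>"
      by (rule continuous_ge_on_closure[OF c]) (use ins \<open>0 < T\<close> in \<open>auto simp: T_def less_imp_le simp del: closure_atLeastLessThan, simp add: cl[unfolded T_def]\<close>)
    ultimately show ?thesis by simp
  qed
  show "a \<le> Z s \<omega> \<and> Z s \<omega> \<le> R" if "0 \<le> s" "s \<le> \<sigma> a R t \<omega>" for s
    using T ins[of s] that by (cases "s = T") (auto simp: T_def)
  show "Z (\<sigma> a R t \<omega>) \<omega> = a \<or> Z (\<sigma> a R t \<omega>) \<omega> = R" if "\<sigma> a R t \<omega> < t"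
    using e(4) that T by (auto simp: T_def)
qed

text \<open>
  The generator \<open>\<Delta>\<^sub>n / 2\<close> applied to \<open>neg_power b (n - 1)\<close> composed with \<open>cosh_rad\<close>.
\<close>

definition drift :: "real \<Rightarrow> real \<Rightarrow> real" where
  "drift b c = real CARD('m) * (real CARD('m) + 1) * (b * c - 1) * neg_power b (CARD('m) + 2) c / 2"

lemma drift_integrable:
  assumes "b < 1" "\<omega> \<in> space M"
  shows "(\<lambda>s. drift b (Z s \<omega>)) integrable_on {0..T}"
proof -
  have "Z s \<omega> - b \<noteq> 0" if "s \<in> {0..T}" for s
    using Z_ge_1[OF _ assms(2), of s] assms(1) that by auto
  then show ?thesis
    unfolding drift_def neg_power_def
    by (intro integrable_continuous_real continuous_intros Z_cont assms) auto
qed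

text \<open>
  Dynkin's formula for the exit from the annulus. Up to the exit the path only sees the region where
  the cutoff is \<open>1\<close>, so the martingale of the compactly supported test function can be rewritten with
  the pure power. Exit value and drift integral are delivered together, as one integrable variable
  \<open>D\<close>, because the bounds on the hitting probability come from comparing their difference pathwise
  with indicators of hitting events.
\<close>

lemma dynkin:
  assumes b: "b < 1" and a: "a < cosh_rad z" and R: "cosh_rad z < R" and t: "0 < t"
  obtains D where "integrable M D" "(\<integral>\<omega>. D \<omega> \<partial>M) = neg_power b CARD('m) (cosh_rad z)"
    and "AE \<omega> in M. D \<omega> = neg_power b CARD('m) (Z (\<sigma> a R t \<omega>) \<omega>)
        - integral {0..\<sigma> a R t \<omega>} (\<lambda>s. drift b (Z s \<omega>))"
proof -
  define f where "f = (radial (trunc_power b CARD('m) R) :: 'm hpoint \<Rightarrow> real)"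
  define P where "P = trunc_power b CARD('m) R"
  define L where "L = radial_laplacian b CARD('m) R"
  note tf = test_function[OF b, where 'm = 'm and R = R, folded f_def, folded P_def L_def]
  define Y where "Y = (\<lambda>t \<omega>. f (X t \<omega>) - f (X 0 \<omega>) - integral {0..t} (\<lambda>s. hyp_laplacian f (X s \<omega>) / 2))"
  have mart: "martingale M (natural_filtration M X) Y"
    unfolding Y_def by (rule X_martingale[OF tf(1)])
  obtain B1 where B1: "\<And>c. 1 \<le> c \<Longrightarrow> \<bar>P c\<bar> \<le> B1" using tf(6) by blast
  obtain B2 where B2: "\<And>c. 1 \<le> c \<Longrightarrow> \<bar>L c\<bar> \<le> B2" using tf(7) by blast
  have f_eq: "f (X s \<omega>) = P (Z s \<omega>)" and L_eq: "hyp_laplacian f (X s \<omega>) = L (Z s \<omega>)"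
    if "0 \<le> s" "\<omega> \<in> space M" for s \<omega>
    using tf(2,3)[OF X_in[OF that]] by (simp_all add: Z_def)
  have comp: "continuous_on {0..s} (\<lambda>u. g (Z u \<omega>))"
    if "continuous_on {1..} g" "\<omega> \<in> space M" for g :: "real \<Rightarrow> real" and s \<omega>
    by (rule continuous_on_compose2[OF that(1) Z_cont[OF that(2)]]) (use Z_ge_1 that in auto)
  have f_cont: "continuous_on {0..s} (\<lambda>u. f (X u \<omega>))" if "\<omega> \<in> space M" for s \<omega>
    by (rule continuous_on_eq[OF comp[OF tf(4) that]]) (simp add: f_eq that)
  have L_cont: "continuous_on {0..s} (\<lambda>u. hyp_laplacian f (X u \<omega>) / 2)" if "\<omega> \<in> space M" for s \<omega>
    by (rule continuous_on_eq[where f = "\<lambda>u. L (Z u \<omega>) / 2"])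
      (use that in \<open>auto intro!: continuous_intros comp tf(5) simp: L_eq\<close>)
  have Y_cont: "continuous_on {0..t} (\<lambda>s. Y s \<omega>)" if "\<omega> \<in> space M" for \<omega>
    unfolding Y_def
    by (intro continuous_intros f_cont indefinite_integral_continuous_1
        integrable_continuous_real L_cont that)
  have Y_bound: "\<bar>Y s \<omega>\<bar> \<le> B1 + B1 + B2 / 2 * t" if s: "0 \<le> s" "s \<le> t" and w: "\<omega> \<in> space M" for s \<omega>
  proof -
    have B2_nonneg: "0 \<le> B2" using B2[of 1] by simp
    have "norm (integral {0..s} (\<lambda>s. hyp_laplacian f (X s \<omega>) / 2)) \<le> B2 / 2 * (s - 0)"
      by (rule integral_bound[OF s(1) L_cont[OF w]]) (use B2 Z_ge_1 w in \<open>auto simp: L_eq\<close>)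
    also have "\<dots> \<le> B2 / 2 * t" using s B2_nonneg by (intro mult_left_mono) auto
    finally have "\<bar>integral {0..s} (\<lambda>s. hyp_laplacian f (X s \<omega>) / 2)\<bar> \<le> B2 / 2 * t" by simp
    moreover have "\<bar>f (X s \<omega>)\<bar> \<le> B1" "\<bar>f (X 0 \<omega>)\<bar> \<le> B1"
      using B1 Z_ge_1 s w by (auto simp: f_eq)
    ultimately show ?thesis unfolding Y_def by linarith
  qed
  have h: "(\<lambda>w :: 'm hpoint. min (cosh_rad w - a) (R - cosh_rad w)) \<in> borel_measurable borel"
    using cosh_rad_measurable by measurable
  have c: "continuous_on {0..t} (\<lambda>s. min (Z s \<omega> - a) (R - Z s \<omega>))" if "\<omega> \<in> space M" for \<omega>
    by (intro continuous_intros Z_cont that)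
  have \<sigma>_bounds: "0 \<le> \<sigma> a R t \<omega>" "\<sigma> a R t \<omega> \<le> t" if "\<omega> \<in> space M" for \<omega>
    unfolding \<sigma>_def by (rule exit_time(1,2)[OF less_imp_le[OF t] c[OF that]])+
  have stop: "{\<omega> \<in> space M. s < \<sigma> a R t \<omega>} \<in> sets (natural_filtration M X s)" if "0 \<le> s" "s < t" for s
    unfolding \<sigma>_def Z_def by (rule exit_time_stopping[OF h that c[unfolded Z_def]])
  note os = optional_stopping[OF prob mart t Y_cont Y_bound \<sigma>_bounds stop]
  have Y_int: "integrable M (\<lambda>\<omega>. Y (\<sigma> a R t \<omega>) \<omega>)"
    by (rule integrable_const_bound[of _ "B1 + B1 + B2 / 2 * t"])
      (use os(1) Y_bound \<sigma>_bounds in \<open>auto intro!: AE_I2\<close>)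
  have "(\<integral>\<omega>. Y (\<sigma> a R t \<omega>) \<omega> \<partial>M) = (\<integral>\<omega>. Y 0 \<omega> \<partial>M)"
    by (rule os(2))
  also have "\<dots> = 0" by (simp add: Y_def)
  finally have Y_mean: "(\<integral>\<omega>. Y (\<sigma> a R t \<omega>) \<omega> \<partial>M) = 0" .
  show ?thesis
  proof (rule that[of "\<lambda>\<omega>. Y (\<sigma> a R t \<omega>) \<omega> + neg_power b CARD('m) (cosh_rad z)"])
    show "integrable M (\<lambda>\<omega>. Y (\<sigma> a R t \<omega>) \<omega> + neg_power b CARD('m) (cosh_rad z))"
      using Y_int by simp
    show "(\<integral>\<omega>. Y (\<sigma> a R t \<omega>) \<omega> + neg_power b CARD('m) (cosh_rad z) \<partial>M) = neg_power b CARD('m) (cosh_rad z)"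
      using Y_int Y_mean by (simp add: prob_space)
    show "AE \<omega> in M. Y (\<sigma> a R t \<omega>) \<omega> + neg_power b CARD('m) (cosh_rad z) =
        neg_power b CARD('m) (Z (\<sigma> a R t \<omega>) \<omega>) - integral {0..\<sigma> a R t \<omega>} (\<lambda>s. drift b (Z s \<omega>))"
      using Z_start AE_space
    proof eventually_elim
      fix \<omega> assume start: "Z 0 \<omega> = cosh_rad z" and w: "\<omega> \<in> space M"
      have a': "a < Z 0 \<omega>" and R': "Z 0 \<omega> < R" using a R start by auto
      note ann = Z_annulus[OF a' R' t w]
      have P_eq: "P (Z s \<omega>) = neg_power b CARD('m) (Z s \<omega>)" if "0 \<le> s" "s \<le> \<sigma> a R t \<omega>" for s
        using ann[OF that] by (simp add: P_def trunc_power_def cutoff_inside)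
      have "integral {0..\<sigma> a R t \<omega>} (\<lambda>s. hyp_laplacian f (X s \<omega>) / 2) =
          integral {0..\<sigma> a R t \<omega>} (\<lambda>s. drift b (Z s \<omega>))"
      proof (rule integral_cong)
        fix s assume "s \<in> {0..\<sigma> a R t \<omega>}"
        then have s: "0 \<le> s" "s \<le> \<sigma> a R t \<omega>" by auto
        have "b < Z s \<omega>" using Z_ge_1[OF s(1) w] b by simp
        with ann[OF s] show "hyp_laplacian f (X s \<omega>) / 2 = drift b (Z s \<omega>)"
          by (simp add: L_eq[OF s(1) w] L_def radial_laplacian_inside drift_def)
      qed
      then show "Y (\<sigma> a R t \<omega>) \<omega> + neg_power b CARD('m) (cosh_rad z) =
          neg_power b CARD('m) (Z (\<sigma> a R t \<omega>) \<omega>) - integral {0..\<sigma> a R t \<omega>} (\<lambda>s. drift b (Z s \<omega>))"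
        using \<sigma>_bounds[OF w] P_eq[of 0] P_eq[of "\<sigma> a R t \<omega>"]
        by (simp add: Y_def f_eq w start)
    qed
  qed
qed

definition hits :: "real \<Rightarrow> 'w set" where
  "hits a = {\<omega> \<in> space M. \<exists>s\<ge>0. Z s \<omega> = a}"

definition hits_before :: "real \<Rightarrow> real \<Rightarrow> 'w set" where
  "hits_before a t = {\<omega> \<in> space M. \<exists>s\<in>{0..t}. Z s \<omega> = a}"

definition stays_below :: "real \<Rightarrow> real \<Rightarrow> 'w set" where
  "stays_below R t = {\<omega> \<in> space M. \<forall>s\<in>{0..t}. Z s \<omega> < R}"

lemma hits_before_measurable:
  assumes "0 \<le> t"
  shows "hits_before a t \<in> sets M"
proof -
  have "{\<omega> \<in> space M. \<forall>u\<in>{0..t}. 0 < \<bar>cosh_rad (X u \<omega>) - a\<bar>} \<in> sets (natural_filtration M X t)"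
    by (rule path_positive_event[of "\<lambda>w. \<bar>cosh_rad w - a\<bar>"])
      (use assms cosh_rad_measurable in
        \<open>auto intro!: continuous_intros Z_cont[unfolded Z_def] borel_measurable_abs borel_measurable_diff\<close>)
  then have "{\<omega> \<in> space M. \<forall>u\<in>{0..t}. 0 < \<bar>cosh_rad (X u \<omega>) - a\<bar>} \<in> sets M"
    using natural_filtration_sets[OF assms] by auto
  moreover have "hits_before a t =
      space M - {\<omega> \<in> space M. \<forall>u\<in>{0..t}. 0 < \<bar>cosh_rad (X u \<omega>) - a\<bar>}"
    by (auto simp: hits_before_def Z_def)
  ultimately show ?thesis by auto
qed

lemma stays_below_measurable:
  assumes "0 \<le> t"
  shows "stays_below R t \<in> sets M"
proof -
  have "{\<omega> \<in> space M. \<forall>u\<in>{0..t}. 0 < R - cosh_rad (X u \<omega>)} \<in> sets (natural_filtration M X t)"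
    by (rule path_positive_event[of "\<lambda>w. R - cosh_rad w"])
      (use assms cosh_rad_measurable in
        \<open>auto intro!: continuous_intros Z_cont[unfolded Z_def] borel_measurable_abs borel_measurable_diff\<close>)
  then show ?thesis
    using natural_filtration_sets[OF assms] by (auto simp: stays_below_def Z_def)
qed

lemma hits_eq: "hits a = (\<Union>n. hits_before a (real n))"
  by (auto simp: hits_def hits_before_def) (metis atLeastAtMost_iff real_arch_simple)

lemma hits_measurable: "hits a \<in> sets M"
  unfolding hits_eq using hits_before_measurable by (intro sets.countable_UN) auto

lemma hits_before_eq: "hits_before a t = (\<Union>n. hits_before a t \<inter> stays_below (real n) t)"
proof (intro equalityI subsetI)
  fix \<omega> assume w: "\<omega> \<in> hits_before a t"
  then have "\<omega> \<in> space M" by (simp add: hits_before_def)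
  then have "bounded ((\<lambda>s. Z s \<omega>) ` {0..t})"
    by (intro compact_imp_bounded compact_continuous_image Z_cont) auto
  then obtain B where B: "\<And>s. s \<in> {0..t} \<Longrightarrow> \<bar>Z s \<omega>\<bar> \<le> B"
    unfolding bounded_iff by (metis imageI real_norm_def)
  obtain n where "B < real n" using reals_Archimedean2 by blast
  then have "\<omega> \<in> stays_below (real n) t"
    using B \<open>\<omega> \<in> space M\<close> by (force simp: stays_below_def)
  with w show "\<omega> \<in> (\<Union>n. hits_before a t \<inter> stays_below (real n) t)" by auto
qed auto

text \<open>
  For \<open>b = 0\<close> the drift is negative, so \<open>D\<close> dominates \<open>p a\<close> times the indicator of hitting level \<open>a\<close> before
  time \<open>t\<close> while staying below \<open>R\<close>. These events increase in \<open>R\<close> for fixed \<open>t\<close>, and their unions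
  increase in \<open>t\<close>, which is why the two limits are taken in this order.
\<close>

lemma prob_hits_upper:
  assumes a: "0 < a" "a < cosh_rad z"
  shows "prob (hits a) \<le> (a / cosh_rad z) ^ CARD('m)"
proof -
  define p where "p = neg_power 0 CARD('m)"
  have pos: "0 < p c" if "0 < c" for c using that by (simp add: p_def neg_power_def)
  have finite_horizon: "prob (hits_before a t \<inter> stays_below R t) \<le> p (cosh_rad z) / p a"
    if t: "0 < t" and R: "cosh_rad z < R" for t R
  proof -
    let ?A = "hits_before a t \<inter> stays_below R t"
    have A: "?A \<in> sets M" using hits_before_measurable stays_below_measurable t by auto
    obtain D where D: "integrable M D" "(\<integral>\<omega>. D \<omega> \<partial>M) = p (cosh_rad z)"
      and D_eq: "AE \<omega> in M. D \<omega> = p (Z (\<sigma> a R t \<omega>) \<omega>) - integral {0..\<sigma> a R t \<omega>} (\<lambda>s. drift 0 (Z s \<omega>))"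
      by (rule dynkin[OF zero_less_one a(2) R t, folded p_def])
    have "AE \<omega> in M. p a * indicator ?A \<omega> \<le> D \<omega>"
      using D_eq Z_start AE_space
    proof eventually_elim
      fix \<omega>
      assume D: "D \<omega> = p (Z (\<sigma> a R t \<omega>) \<omega>) - integral {0..\<sigma> a R t \<omega>} (\<lambda>s. drift 0 (Z s \<omega>))"
        and start: "Z 0 \<omega> = cosh_rad z" and w: "\<omega> \<in> space M"
      have a': "a < Z 0 \<omega>" and R': "Z 0 \<omega> < R" using a R start by auto
      define T where "T = \<sigma> a R t \<omega>"
      note path = \<sigma>_nonneg[OF a' R' t w] \<sigma>_le[OF a' R' t w] Z_annulus[OF a' R' t w]
        Z_inside[OF a' R' t w] Z_exit[OF a' R' t w]
      note path = path[folded T_def]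
      have "drift 0 (Z s \<omega>) \<le> 0" if "s \<in> {0..T}" for s
        using Z_ge_1[OF _ w, of s] that by (simp add: drift_def neg_power_def)
      then have "integral {0..T} (\<lambda>s. drift 0 (Z s \<omega>)) \<le> integral {0..T} (\<lambda>s. 0)"
        using w by (intro integral_le drift_integrable) auto
      moreover have "p a \<le> p (Z T \<omega>)" if hit: "\<omega> \<in> ?A"
      proof -
        obtain s where s: "0 \<le> s" "s \<le> t" "Z s \<omega> = a"
          using hit by (auto simp: hits_before_def)
        have "T \<le> s" using path(4)[of s] s by force
        moreover have "Z T \<omega> \<noteq> R" using hit path by (force simp: stays_below_def)
        ultimately have "Z T \<omega> = a" using path(2,5) s by (cases "T = t") auto
        then show ?thesis by simp
      qed
      moreover have "0 < p (Z T \<omega>)"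
        using Z_ge_1[OF path(1) w] by (intro pos) simp
      ultimately show "p a * indicator ?A \<omega> \<le> D \<omega>"
        unfolding D T_def[symmetric] by (auto split: split_indicator)
    qed
    then have "(\<integral>\<omega>. p a * indicator ?A \<omega> \<partial>M) \<le> (\<integral>\<omega>. D \<omega> \<partial>M)"
      using A D(1) by (intro integral_mono_AE) (auto intro!: integrable_mult_right integrable_real_indicator simp: emeasure_eq_measure)
    then have "p a * prob ?A \<le> p (cosh_rad z)"
      using A D(2) by simp
    then show ?thesis using pos[OF a(1)] by (simp add: pos_le_divide_eq mult.commute)
  qed
  have before: "prob (hits_before a t) \<le> p (cosh_rad z) / p a" if t: "0 < t" for t
  proof (rule LIMSEQ_le_const2)
    have "(\<lambda>n. prob (hits_before a t \<inter> stays_below (real n) t)) \<longlonglongrightarrow>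
        prob (\<Union>n. hits_before a t \<inter> stays_below (real n) t)"
    proof (rule finite_Lim_measure_incseq)
      show "range (\<lambda>n. hits_before a t \<inter> stays_below (real n) t) \<subseteq> sets M"
        using hits_before_measurable stays_below_measurable t by auto
      have "stays_below (real m) t \<subseteq> stays_below (real n) t" if "m \<le> n" for m n
        using that by (fastforce simp: stays_below_def)
      then show "incseq (\<lambda>n. hits_before a t \<inter> stays_below (real n) t)"
        unfolding incseq_def by blast
    qed
    then show "(\<lambda>n. prob (hits_before a t \<inter> stays_below (real n) t)) \<longlonglongrightarrow> prob (hits_before a t)"
      unfolding hits_before_eq[symmetric] .
    obtain N where "cosh_rad z < real N" using reals_Archimedean2 by blast
    then show "\<exists>N. \<forall>n\<ge>N. prob (hits_before a t \<inter> stays_below (real n) t) \<le> p (cosh_rad z) / p a"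
      by (intro exI[of _ N] allI impI finite_horizon t) auto
  qed
  have "prob (hits a) \<le> p (cosh_rad z) / p a"
  proof (rule LIMSEQ_le_const2)
    show "(\<lambda>n. prob (hits_before a (real n))) \<longlonglongrightarrow> prob (hits a)"
      unfolding hits_eq
    proof (rule finite_Lim_measure_incseq)
      show "range (\<lambda>n. hits_before a (real n)) \<subseteq> sets M"
        using hits_before_measurable by auto
      have "hits_before a (real m) \<subseteq> hits_before a (real n)" if "m \<le> n" for m n
        using that by (fastforce simp: hits_before_def)
      then show "incseq (\<lambda>n. hits_before a (real n))"
        unfolding incseq_def by blast
    qed
    show "\<exists>N. \<forall>n\<ge>N. prob (hits_before a (real n)) \<le> p (cosh_rad z) / p a"
      by (intro exI[of _ 1] allI impI before) auto
  qed
  then show ?thesis by (simp add: p_def neg_power_def power_divide)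
qed

text \<open>
  With \<open>1 / a < b < 1\<close> the drift is bounded below by some \<open>\<kappa> > 0\<close> on the annulus. A path leaves through
  level \<open>a\<close>, where it has hit, or through level \<open>R\<close>, where \<open>p\<close> is small, or is still inside at time \<open>t\<close>,
  where the drift has used up all of \<open>p\<close>. Strict subharmonicity is what forces the paths out of
  the annulus, and letting \<open>R\<close> grow gives \<open>p (cosh_rad z) \<le> p a * prob (hits a)\<close>.
\<close>

lemma prob_hits_lower:
  assumes a: "1 < a" "a < cosh_rad z"
  shows "((a - 1) / cosh_rad z) ^ CARD('m) \<le> prob (hits a)"
proof -
  define b where "b = 2 / (1 + a)"
  have b: "0 < b" "b < 1" "1 < b * a" using a by (auto simp: b_def field_simps)
  define p where "p = neg_power b CARD('m)"
  have p_pos: "0 < p c" if "1 \<le> c" for c using that b by (simp add: p_def neg_power_def)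
  have bound: "p (cosh_rad z) - p R \<le> p a * prob (hits a)" if R: "cosh_rad z < R" for R
  proof -
    define \<kappa> where "\<kappa> = real CARD('m) * (real CARD('m) + 1) * (b * a - 1) * neg_power b (CARD('m) + 2) R / 2"
    have \<kappa>: "0 < \<kappa>" using b a R by (simp add: \<kappa>_def neg_power_def)
    have drift_ge: "\<kappa> \<le> drift b c" if "a \<le> c" "c \<le> R" for c
    proof -
      have "neg_power b (CARD('m) + 2) R \<le> neg_power b (CARD('m) + 2) c"
        unfolding neg_power_def using that a b
        by (intro divide_left_mono power_mono mult_pos_pos zero_less_power) auto
      moreover have ba: "b * a \<le> b * c" using that b by simp
      moreover have "1 \<le> b * c" using ba b by linarith
      ultimately show ?thesis
        unfolding \<kappa>_def drift_def using that a b
        by (intro divide_right_mono mult_mono mult_nonneg_nonneg) (auto simp: neg_power_def)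
    qed
    \<comment> \<open>By this time the accumulated drift is at least the maximum of \<open>p\<close> on the annulus, so paths
      that are still inside contribute nothing positive.\<close>
    define t where "t = p a / \<kappa>"
    have t: "0 < t" using \<kappa> p_pos a by (simp add: t_def)
    obtain D where D: "integrable M D" "(\<integral>\<omega>. D \<omega> \<partial>M) = p (cosh_rad z)"
      and D_eq: "AE \<omega> in M. D \<omega> = p (Z (\<sigma> a R t \<omega>) \<omega>) - integral {0..\<sigma> a R t \<omega>} (\<lambda>s. drift b (Z s \<omega>))"
      by (rule dynkin[OF b(2) a(2) R t, folded p_def])
    have "AE \<omega> in M. D \<omega> \<le> p a * indicator (hits a) \<omega> + p R"
      using D_eq Z_start AE_space
    proof eventually_elim
      fix \<omega>
      assume D: "D \<omega> = p (Z (\<sigma> a R t \<omega>) \<omega>) - integral {0..\<sigma> a R t \<omega>} (\<lambda>s. drift b (Z s \<omega>))"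
        and start: "Z 0 \<omega> = cosh_rad z" and w: "\<omega> \<in> space M"
      have a': "a < Z 0 \<omega>" and R': "Z 0 \<omega> < R" using a R start by auto
      define T where "T = \<sigma> a R t \<omega>"
      note path = \<sigma>_nonneg[OF a' R' t w] \<sigma>_le[OF a' R' t w] Z_annulus[OF a' R' t w]
        Z_inside[OF a' R' t w] Z_exit[OF a' R' t w]
      note path = path[folded T_def]
      have "integral {0..T} (\<lambda>s. \<kappa>) \<le> integral {0..T} (\<lambda>s. drift b (Z s \<omega>))"
        using path(3) drift_ge b w by (intro integral_le drift_integrable) auto
      then have I: "\<kappa> * T \<le> integral {0..T} (\<lambda>s. drift b (Z s \<omega>))"
        using path(1) by (simp add: mult.commute)
      have I0: "0 \<le> \<kappa> * T" using \<kappa> path(1) by simp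
      have pR: "0 < p R" and pa: "0 < p a" using p_pos a R by auto
      have "p (Z T \<omega>) - \<kappa> * T \<le> p a * indicator (hits a) \<omega> + p R"
      proof (cases "Z T \<omega> = a \<or> Z T \<omega> = R")
        case True
        then show ?thesis
        proof
          assume "Z T \<omega> = a"
          then have "\<omega> \<in> hits a" using w path(1) by (auto simp: hits_def)
          then show ?thesis using \<open>Z T \<omega> = a\<close> I0 pR by simp
        next
          assume "Z T \<omega> = R"
          moreover have "0 \<le> p a * indicator (hits a) \<omega>" using pa by simp
          ultimately show ?thesis using I0 by simp
        qed
      next
        case False
        then have "T = t" using path(2,5) by force
        then have "\<kappa> * T = p a" using \<kappa> by (simp add: t_def)
        moreover have "p (Z T \<omega>) \<le> p a"
          unfolding p_def neg_power_def using path(1,3) a b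
          by (intro divide_left_mono power_mono mult_pos_pos zero_less_power) force+
        moreover have "0 \<le> p a * indicator (hits a) \<omega>" using pa by simp
        ultimately show ?thesis using pR by linarith
      qed
      with I show "D \<omega> \<le> p a * indicator (hits a) \<omega> + p R"
        unfolding D T_def[symmetric] by linarith
    qed
    moreover have i: "integrable M (\<lambda>\<omega>. p a * indicator (hits a) \<omega>)"
      using hits_measurable by (auto intro!: integrable_mult_right integrable_real_indicator simp: emeasure_eq_measure)
    ultimately have "(\<integral>\<omega>. D \<omega> \<partial>M) \<le> (\<integral>\<omega>. p a * indicator (hits a) \<omega> + p R \<partial>M)"
      using D(1) by (intro integral_mono_AE) auto
    also have "\<dots> = p a * prob (hits a) + p R"
      using i hits_measurable by (subst Bochner_Integration.integral_add) (auto simp: prob_space)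
    finally show ?thesis using D(2) by simp
  qed
  have "p (cosh_rad z) - 0 \<le> p a * prob (hits a)"
  proof (rule tendsto_upperbound)
    have "filterlim (\<lambda>R. (R - b) ^ CARD('m)) at_top at_top"
      by (rule filterlim_pow_at_top) (simp, real_asymp)
    then have "(p \<longlongrightarrow> 0) at_top"
      unfolding p_def neg_power_def[abs_def] by (rule real_tendsto_divide_at_top[OF tendsto_const])
    then show "((\<lambda>R. p (cosh_rad z) - p R) \<longlongrightarrow> p (cosh_rad z) - 0) at_top"
      by (intro tendsto_intros)
    show "\<forall>\<^sub>F R in at_top. p (cosh_rad z) - p R \<le> p a * prob (hits a)"
      using eventually_gt_at_top[of "cosh_rad z"] by eventually_elim (rule bound)
  qed simp
  then have "p (cosh_rad z) / p a \<le> prob (hits a)"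
    using p_pos[of a] a by (simp add: pos_divide_le_eq mult.commute)
  moreover have "((a - 1) / cosh_rad z) ^ CARD('m) \<le> ((a - b) / (cosh_rad z - b)) ^ CARD('m)"
    using a b by (intro power_mono frac_le) auto
  ultimately show ?thesis by (simp add: p_def neg_power_def power_divide)
qed

lemma hits_eq_hitting_time:
  assumes "0 < r"
  shows "{\<omega> \<in> space M. hitting_time X (hyp_sphere r) \<omega> < \<infinity>} = hits (cosh r)"
proof -
  have sphere: "w \<in> hyp_sphere r \<longleftrightarrow> cosh_rad w = cosh r" if "w \<in> hyp_space" for w :: "'m hpoint"
  proof -
    have "0 \<le> hyp_dist w hyp_origin"
      using that by (intro cosh_hyp_dist(1)) (auto simp: hyp_space_def hyp_origin_def)
    then have "hyp_dist w hyp_origin = r \<longleftrightarrow> cosh (hyp_dist w hyp_origin) = cosh r"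
      using assms by (metis arcosh_cosh_real less_imp_le)
    then show ?thesis using that by (simp add: hyp_sphere_def cosh_rad_eq)
  qed
  have "hitting_time X (hyp_sphere r) \<omega> < \<infinity> \<longleftrightarrow> (\<exists>s\<ge>0. Z s \<omega> = cosh r)" if "\<omega> \<in> space M" for \<omega>
  proof -
    have "hitting_time X (hyp_sphere r) \<omega> < \<infinity> \<longleftrightarrow> (\<exists>s\<ge>0. X s \<omega> \<in> hyp_sphere r)"
      unfolding hitting_time_def Inf_less_iff by auto
    also have "\<dots> \<longleftrightarrow> (\<exists>s\<ge>0. Z s \<omega> = cosh r)"
      unfolding Z_def using sphere[OF X_in[OF _ that]] by blast
    finally show ?thesis .
  qed
  then show ?thesis
    unfolding hits_def by blast
qed

end

lemma ln_power_cosh_limit: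
  assumes "0 < C"
  shows "((\<lambda>r. (1 / r) * ln ((C / cosh r) ^ k)) \<longlongrightarrow> - real k) at_top"
proof -
  have "((\<lambda>r. real k * ((ln C - ln (cosh r)) / r)) \<longlongrightarrow> real k * (-1)) at_top"
  proof (intro tendsto_intros)
    show "((\<lambda>r. (ln C - ln (cosh r)) / r) \<longlongrightarrow> - 1) at_top"
      unfolding cosh_field_def by real_asymp
  qed
  moreover have "(1 / r) * ln ((C / cosh r) ^ k) = real k * ((ln C - ln (cosh r)) / r)" for r :: real
  proof -
    have "ln ((C / cosh r) ^ k) = real k * (ln C - ln (cosh r))"
      using assms by (subst ln_realpow) (auto simp: ln_div)
    then show ?thesis by simp
  qed
  ultimately show ?thesis by (simp only: mult_minus_right mult_1_right)
qed

theorem mainTheorem3: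
  fixes n :: nat
    and \<eta>\<^sub>1 :: real
    and M :: "real \<Rightarrow> 'w measure"
    and X :: "real \<Rightarrow> real \<Rightarrow> 'w \<Rightarrow> ('m::finite) hpoint"
    and z :: "real \<Rightarrow> 'm hpoint"
  assumes "n = CARD('m) + 1"
    and "n \<in> {2, 3, 4, 5, 6, 7}"
    and "\<eta>\<^sub>1 > 0"
    and "\<And>\<eta>. \<eta> > \<eta>\<^sub>1 \<Longrightarrow> hyp_dist (z \<eta>) hyp_origin = \<eta>"
    and "\<And>\<eta>. \<eta> > \<eta>\<^sub>1 \<Longrightarrow> hyperbolic_BM (M \<eta>) (X \<eta>) (z \<eta>)"
  shows "((\<lambda>\<eta>. (1 / \<eta>) *
            ln (measure (M \<eta>) {\<omega> \<in> space (M \<eta>). hitting_time (X \<eta>) (hyp_sphere \<eta>\<^sub>1) \<omega> < \<infinity>}))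
          \<longlongrightarrow> - (real n - 1)) at_top"
proof -
  define a where "a = cosh \<eta>\<^sub>1"
  define P where "P \<eta> = measure (M \<eta>) {\<omega> \<in> space (M \<eta>). hitting_time (X \<eta>) (hyp_sphere \<eta>\<^sub>1) \<omega> < \<infinity>}" for \<eta>
  have a: "1 < a" using cosh_real_strict_mono[of 0 \<eta>\<^sub>1] \<open>\<eta>\<^sub>1 > 0\<close> by (simp add: a_def)
  have P: "((a - 1) / cosh \<eta>) ^ CARD('m) \<le> P \<eta>" "P \<eta> \<le> (a / cosh \<eta>) ^ CARD('m)" if "\<eta> > \<eta>\<^sub>1" for \<eta>
  proof -
    interpret hyp_BM "M \<eta>" "X \<eta>" "z \<eta>" using assms(5)[OF that] by unfold_locales
    have "cosh_rad (z \<eta>) = cosh \<eta>"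
      using cosh_rad_eq[OF z_in] assms(4)[OF that] by simp
    moreover have "a < cosh \<eta>"
      using that \<open>\<eta>\<^sub>1 > 0\<close> unfolding a_def by (intro cosh_real_strict_mono) auto
    moreover have "P \<eta> = prob (hits a)"
      unfolding P_def a_def hits_eq_hitting_time[OF \<open>\<eta>\<^sub>1 > 0\<close>] ..
    ultimately show "((a - 1) / cosh \<eta>) ^ CARD('m) \<le> P \<eta>" "P \<eta> \<le> (a / cosh \<eta>) ^ CARD('m)"
      using prob_hits_lower[of a] prob_hits_upper[of a] a by auto
  qed
  have low_pos: "0 < ((a - 1) / cosh \<eta>) ^ CARD('m)" for \<eta> using a by simp
  have "((\<lambda>\<eta>. (1 / \<eta>) * ln (P \<eta>)) \<longlongrightarrow> - real CARD('m)) at_top"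
  proof (rule tendsto_sandwich)
    show "((\<lambda>\<eta>. (1 / \<eta>) * ln (((a - 1) / cosh \<eta>) ^ CARD('m))) \<longlongrightarrow> - real CARD('m)) at_top"
      using a by (intro ln_power_cosh_limit) simp
    show "((\<lambda>\<eta>. (1 / \<eta>) * ln ((a / cosh \<eta>) ^ CARD('m))) \<longlongrightarrow> - real CARD('m)) at_top"
      using a by (intro ln_power_cosh_limit) simp
    show "\<forall>\<^sub>F \<eta> in at_top. (1 / \<eta>) * ln (((a - 1) / cosh \<eta>) ^ CARD('m)) \<le> (1 / \<eta>) * ln (P \<eta>)"
      using eventually_gt_at_top[of \<eta>\<^sub>1]
    proof eventually_elim
      fix \<eta> assume h: "\<eta> > \<eta>\<^sub>1"
      show "(1 / \<eta>) * ln (((a - 1) / cosh \<eta>) ^ CARD('m)) \<le> (1 / \<eta>) * ln (P \<eta>)"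
        using P(1)[OF h] low_pos[of \<eta>] h \<open>\<eta>\<^sub>1 > 0\<close> by (intro mult_left_mono ln_mono) auto
    qed
    show "\<forall>\<^sub>F \<eta> in at_top. (1 / \<eta>) * ln (P \<eta>) \<le> (1 / \<eta>) * ln ((a / cosh \<eta>) ^ CARD('m))"
      using eventually_gt_at_top[of \<eta>\<^sub>1]
    proof eventually_elim
      fix \<eta> assume h: "\<eta> > \<eta>\<^sub>1"
      have "0 < P \<eta>" using less_le_trans[OF low_pos P(1)[OF h]] .
      then show "(1 / \<eta>) * ln (P \<eta>) \<le> (1 / \<eta>) * ln ((a / cosh \<eta>) ^ CARD('m))"
        using P(2)[OF h] h \<open>\<eta>\<^sub>1 > 0\<close> by (intro mult_left_mono ln_mono) auto
    qed
  qed
  then show ?thesis using \<open>n = CARD('m) + 1\<close> by (simp add: P_def)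
qed

end
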